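(* Assume that $W_t=Y_t-\widehat\mu(X_t)=\sum_{j=0}^\infty a_j\varepsilon_{t-j}$, $t\in\mathbb Z$, where $\varepsilon_t$ are iid $N(0,1)$, $a_0\ne0$, $a_j\sim c\,j^{-\beta}$ as $j\to\infty$ with $c>0$ and $1/2<\beta<1$, and assume the refinement $a_j=j^{-\beta}\{c+O(j^{-\varphi})\}$ for some $\varphi>0$. Let $h=\lfloor\sqrt n\rfloor$ and let $\widehat\beta$ be the estimator defined in the context. Then, as $n\to\infty$, for any $0<\delta<\min(\varphi,1-\beta)$, $$\widehat\beta-\beta=O_{\mathbb P}(h^{-\delta}+v_{n,h}),\qquad v_{n,h}=\begin{cases}(h/n)^{2\beta-1},&\beta<3/4,\\ \sqrt{(h/n)\{1+\log(n/h)\}},&\beta=3/4,\\ \sqrt{h/n},&\beta>3/4.\end{cases}$$ In particular $(\widehat\beta-\beta)\log n=o_{\mathbb P}(1)$, and $\widehat r_N/R_N(\beta)\to1$ in probability for $N=b$ and $N=n$. For each fixed $\beta\in(1/2,1)$, $R_N(\beta)/r_N$ converges, as $N\to\infty$, to a strictly positive finite constant.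
   Context: $Z_t=(X_t,Y_t)$ is a stationary time series and $\widehat\mu$ is a fixed (nonrandom) predictor, with observed calibration residuals $W_1,\ldots,W_n$. Let $b=\lfloor n^\zeta\rfloor$ for a fixed $0<\zeta<1$. For $l=h,2h$, $$\widehat Q_l=\frac1{n-l+1}\sum_{i=0}^{n-l}\left(\sum_{t=i+1}^{i+l}W_t\right)^2,\qquad \widehat\beta=\frac32-\frac{\log(\widehat Q_{2h}/\widehat Q_h)}{2\log2},$$ with the convention $\widehat\beta=3/4$ if $\widehat Q_h$ or $\widehat Q_{2h}$ is zero. For real $u$, $$R_N(u)=\left\{\frac{1+\int_1^Nx^{2-4u}\,dx}{N}\right\}^{1/2},\qquad \widehat r_N=R_N(\widehat\beta),\quad N=b,n.$$ The rate is $r_N=N^{-1/2}$ if $3/4<\beta<1$, $r_N=\sqrt{\log N/N}$ if $\beta=3/4$, and $r_N=N^{1-2\beta}$ if $1/2<\beta<3/4$. *)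

theory Defs
  imports "HOL-Probability.Probability" "HOL-Library.Landau_Symbols"
begin

definition strictly_stationary :: "'a measure \<Rightarrow> 'b measure \<Rightarrow> (int \<Rightarrow> 'a \<Rightarrow> 'b) \<Rightarrow> bool" where
  "strictly_stationary M S Z \<longleftrightarrow>
     (\<forall>t. Z t \<in> measurable M S) \<and>
     (\<forall>k. distr M (PiM UNIV (\<lambda>_. S)) (\<lambda>\<omega> t. Z (t + k) \<omega>) =
          distr M (PiM UNIV (\<lambda>_. S)) (\<lambda>\<omega> t. Z t \<omega>))"

text \<open>
  In the two definitions below measurability is part of the notion, since \<^const>\<open>measure\<close>
  takes the value 0 on sets that are not measurable.
\<close>

definition bounded_in_prob :: "'a measure \<Rightarrow> (nat \<Rightarrow> 'a \<Rightarrow> real) \<Rightarrow> (nat \<Rightarrow> real) \<Rightarrow> bool" where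
  "bounded_in_prob M X r \<longleftrightarrow>
     (\<forall>n. X n \<in> borel_measurable M) \<and>
     (\<forall>e>0. \<exists>C>0. \<forall>\<^sub>F n in sequentially.
        measure M {\<omega> \<in> space M. \<bar>X n \<omega>\<bar> > C * r n} \<le> e)"

definition tendsto_in_prob :: "'a measure \<Rightarrow> (nat \<Rightarrow> 'a \<Rightarrow> real) \<Rightarrow> real \<Rightarrow> bool" where
  "tendsto_in_prob M X L \<longleftrightarrow>
     (\<forall>n. X n \<in> borel_measurable M) \<and>
     (\<forall>e>0. (\<lambda>n. measure M {\<omega> \<in> space M. \<bar>X n \<omega> - L\<bar> > e}) \<longlonglongrightarrow> 0)"

text \<open>The sample is \<open>w 1, \<dots>, w n\<close>; no other value of \<open>w\<close> enters the next two definitions.\<close>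

definition Qhat :: "(int \<Rightarrow> real) \<Rightarrow> nat \<Rightarrow> nat \<Rightarrow> real" where
  "Qhat w n l =
     (\<Sum>i = 0..int n - int l. (\<Sum>t = i + 1..i + int l. w t)\<^sup>2) / (real n - real l + 1)"

definition betahat :: "(int \<Rightarrow> real) \<Rightarrow> nat \<Rightarrow> nat \<Rightarrow> real" where
  "betahat w n h =
     (if Qhat w n h = 0 \<or> Qhat w n (2 * h) = 0 then 3 / 4
      else 3 / 2 - ln (Qhat w n (2 * h) / Qhat w n h) / (2 * ln 2))"

definition R :: "nat \<Rightarrow> real \<Rightarrow> real" where
  "R N u = sqrt ((1 + integral {1..real N} (\<lambda>x. x powr (2 - 4 * u))) / real N)"

definition rate :: "real \<Rightarrow> nat \<Rightarrow> real" where
  "rate \<beta> N =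
     (if \<beta> > 3 / 4 then real N powr (- 1 / 2)
      else if \<beta> = 3 / 4 then sqrt (ln (real N) / real N)
      else real N powr (1 - 2 * \<beta>))"

definition vrate :: "real \<Rightarrow> nat \<Rightarrow> nat \<Rightarrow> real" where
  "vrate \<beta> n h =
     (if \<beta> < 3 / 4 then (real h / real n) powr (2 * \<beta> - 1)
      else if \<beta> = 3 / 4 then sqrt ((real h / real n) * (1 + ln (real n / real h)))
      else sqrt (real h / real n))"

definition hseq :: "nat \<Rightarrow> nat" where
  "hseq n = nat \<lfloor>sqrt (real n)\<rfloor>"

definition bseq :: "real \<Rightarrow> nat \<Rightarrow> nat" where
  "bseq \<zeta> n = nat \<lfloor>real n powr \<zeta>\<rfloor>"

end

theory Submission
  imports Defs "HOL-Real_Asymp.Real_Asymp"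
begin

text \<open>
  Let \<open>V l\<close> be the variance of a sum of \<open>l\<close> consecutive residuals. The statistic \<open>Q\<^sub>l\<close> is an
  unbiased estimator of \<open>V l\<close>, and \<open>V l\<close> grows like a constant times \<open>l powr (3 - 2 * \<beta>)\<close>, so the
  logarithm of \<open>Q\<^sub>2\<^sub>h / Q\<^sub>h\<close> to base 2 is close to \<open>3 - 2 * \<beta>\<close>. The two terms of the rate are the
  two errors made here: \<open>h powr (- \<delta>)\<close> is the deterministic bias of \<open>V (2 * h) / V h\<close>, and
  \<open>vrate\<close> is the order of the relative standard deviation of \<open>Q\<^sub>l\<close>.

  Bias. Up to a relative error \<open>k powr (- \<delta>)\<close> the autocovariance at lag \<open>k\<close> is \<open>c\<^sup>2\<close> times the
  autocovariance \<open>f k\<close> of the exact power law \<open>j powr (- \<beta>)\<close>, \<open>j \<ge> 1\<close>. The estimator sees \<open>V\<close> only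
  through its behaviour under doubling of \<open>l\<close>, which can be read off the series: grouping the terms
  of the series for \<open>f (2 * k)\<close> in pairs gives
  \<open>f (2 * k) = 2 powr (1 - 2 * \<beta>) * f k + O(k powr (- \<beta>))\<close>, and splitting the \<open>2 * l\<close> times of a
  block by parity carries this over to
  \<open>V (2 * l) = 2 powr (3 - 2 * \<beta>) * V l + O(l powr (3 - 2 * \<beta> - \<delta>))\<close>
  (\<open>block_variance_double\<close>).

  Variance. For Gaussian variables the covariance of two squares is twice the square of their
  covariance, so the variance of \<open>Q\<^sub>l\<close> is an average of squared covariances of pairs of blocks.
  Pairs at distance less than \<open>2 * l\<close> are controlled by the inequality of Cauchy and Schwarz; for
  pairs at distance \<open>d \<ge> 2 * l\<close> the covariance is \<open>O(l\<^sup>2 * d powr (1 - 2 * \<beta>))\<close>. The sum of the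
  squares, averaged and divided by \<open>V l ^ 2\<close>, is at most of the order of
  \<open>l / n + l powr (4 * \<beta> - 2) / n\<close> times the sum of \<open>d powr (2 - 4 * \<beta>)\<close> over \<open>l < d \<le> n\<close>, and the three
  regimes of \<open>vrate\<close> are those of the last sum (\<open>block_variance_bound\<close>). The residuals are infinite
  series in the innovations; the variance identity is proved for finite windows of innovations, and
  Fatou's lemma transfers it as an upper bound, which is what Chebyshev's inequality uses
  (\<open>Qhat_second_moment\<close>).

  Consequences. Both terms of the rate are powers of \<open>n\<close> up to logarithms, so the error times
  \<open>ln n\<close> tends to zero. On \<open>[1, N]\<close> the integrands of \<open>R N u\<close> and \<open>R N \<beta>\<close> differ by a factor of at most
  \<open>N powr (4 * \<bar>u - \<beta>\<bar>)\<close>, so the ratio of the two values of \<open>R\<close> lies between \<open>exp (- x)\<close> and \<open>exp x\<close>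
  with \<open>x = 2 * \<bar>u - \<beta>\<bar> * ln N\<close>. The limit of \<open>R N u / rate u N\<close> follows from the closed form
  of the integral.
\<close>

section \<open>Quadratic forms in independent Gaussian variables\<close>

context prob_space
begin

text \<open>
  Terms with coefficient 0 are removed first, because \<open>sum_indep_normal\<close> deals with
  nondegenerate normal distributions; the empty sum is then a separate case.
\<close>

lemma gaussian_sum_moments:
  fixes \<epsilon> :: "'i \<Rightarrow> 'a \<Rightarrow> real" and u :: "'i \<Rightarrow> real"
  assumes indep: "indep_vars (\<lambda>_. borel) \<epsilon> UNIV"
    and normal: "\<And>k. distributed M lborel (\<epsilon> k) std_normal_density"
    and K: "finite K"
  shows "has_bochner_integral M (\<lambda>\<omega>. (\<Sum>k\<in>K. u k * \<epsilon> k \<omega>)\<^sup>2) (\<Sum>k\<in>K. (u k)\<^sup>2)"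
    and "has_bochner_integral M (\<lambda>\<omega>. (\<Sum>k\<in>K. u k * \<epsilon> k \<omega>) ^ 4) (3 * (\<Sum>k\<in>K. (u k)\<^sup>2)\<^sup>2)"
proof -
  define J where "J = {k\<in>K. u k \<noteq> 0}"
  define s where "s = (\<Sum>k\<in>K. (u k)\<^sup>2)"
  have J: "finite J" using K by (simp add: J_def)
  have sJ: "s = (\<Sum>k\<in>J. (u k)\<^sup>2)"
    unfolding s_def J_def by (rule sum.mono_neutral_right) (use K in auto)
  have UJ: "(\<Sum>k\<in>K. u k * \<epsilon> k \<omega>) = (\<Sum>k\<in>J. u k * \<epsilon> k \<omega>)" for \<omega>
    unfolding J_def by (rule sum.mono_neutral_right) (use K in auto)
  have moment: "has_bochner_integral M (\<lambda>\<omega>. (\<Sum>k\<in>J. u k * \<epsilon> k \<omega>) ^ (2 * p))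
      (fact (2 * p) / ((2 / s) ^ p * fact p))" if "J \<noteq> {}" for p
  proof -
    have spos: "s > 0"
      unfolding sJ by (rule sum_pos) (use that J in \<open>auto simp: J_def\<close>)
    have "distributed M lborel (\<lambda>\<omega>. u k * \<epsilon> k \<omega>) (normal_density 0 \<bar>u k\<bar>)" if "k \<in> J" for k
      using normal_density_affine[OF normal[of k], of "u k" 0] that by (simp add: J_def)
    moreover have "indep_vars (\<lambda>_. borel) (\<lambda>k \<omega>. u k * \<epsilon> k \<omega>) J"
      by (rule indep_vars_compose2[OF indep_vars_subset[OF indep]]) auto
    ultimately have "distributed M lborel (\<lambda>\<omega>. \<Sum>k\<in>J. u k * \<epsilon> k \<omega>)
        (normal_density (\<Sum>k\<in>J. 0) (sqrt (\<Sum>k\<in>J. \<bar>u k\<bar>\<^sup>2)))"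
      using J that by (intro sum_indep_normal) (auto simp: J_def)
    then have D: "distributed M lborel (\<lambda>\<omega>. \<Sum>k\<in>J. u k * \<epsilon> k \<omega>) (normal_density 0 (sqrt s))"
      by (simp add: sJ)
    have N: "has_bochner_integral lborel (\<lambda>x. normal_density 0 (sqrt s) x * x ^ (2 * p))
        (fact (2 * p) / ((2 / s) ^ p * fact p))"
      using normal_moment_even[where \<mu> = 0 and \<sigma> = "sqrt s" and k = p] spos
      by (simp only: real_sqrt_gt_zero real_sqrt_pow2[OF less_imp_le[OF spos]] diff_zero)
    have "integrable M (\<lambda>\<omega>. (\<Sum>k\<in>J. u k * \<epsilon> k \<omega>) ^ (2 * p))"
      using distributed_integrable[OF D, of "\<lambda>x. x ^ (2 * p)"] N
      by (auto simp: has_bochner_integral_iff)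
    moreover have "(\<integral>\<omega>. (\<Sum>k\<in>J. u k * \<epsilon> k \<omega>) ^ (2 * p) \<partial>M) = fact (2 * p) / ((2 / s) ^ p * fact p)"
      using distributed_integral[OF D, of "\<lambda>x. x ^ (2 * p)"] N
      by (auto simp: has_bochner_integral_iff)
    ultimately show ?thesis by (simp add: has_bochner_integral_iff)
  qed
  show "has_bochner_integral M (\<lambda>\<omega>. (\<Sum>k\<in>K. u k * \<epsilon> k \<omega>)\<^sup>2) (\<Sum>k\<in>K. (u k)\<^sup>2)"
  proof (cases "J = {}")
    case False
    then show ?thesis
      using moment[of 1] unfolding UJ s_def[symmetric] by simp
  next
    case True
    then show ?thesis unfolding UJ s_def[symmetric] by (simp add: sJ has_bochner_integral_zero)
  qed
  show "has_bochner_integral M (\<lambda>\<omega>. (\<Sum>k\<in>K. u k * \<epsilon> k \<omega>) ^ 4) (3 * (\<Sum>k\<in>K. (u k)\<^sup>2)\<^sup>2)"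
  proof (cases "J = {}")
    case False
    then show ?thesis
      using moment[of 2] unfolding UJ s_def[symmetric]
      by (simp add: fact_numeral power_divide)
  next
    case True
    then show ?thesis unfolding UJ s_def[symmetric] by (simp add: sJ has_bochner_integral_zero)
  qed
qed

text \<open>
  This is Isserlis' formula for two linear forms. By polarisation the product of two squares is a
  combination of fourth powers of linear forms, and a linear form is again normal.
\<close>

lemma gaussian_sum_square_product:
  fixes \<epsilon> :: "'i \<Rightarrow> 'a \<Rightarrow> real" and u v :: "'i \<Rightarrow> real"
  assumes indep: "indep_vars (\<lambda>_. borel) \<epsilon> UNIV"
    and normal: "\<And>k. distributed M lborel (\<epsilon> k) std_normal_density"
    and K: "finite K"
  shows "has_bochner_integral M
      (\<lambda>\<omega>. (\<Sum>k\<in>K. u k * \<epsilon> k \<omega>)\<^sup>2 * (\<Sum>k\<in>K. v k * \<epsilon> k \<omega>)\<^sup>2)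
      ((\<Sum>k\<in>K. (u k)\<^sup>2) * (\<Sum>k\<in>K. (v k)\<^sup>2) + 2 * (\<Sum>k\<in>K. u k * v k)\<^sup>2)"
proof -
  note m4 = gaussian_sum_moments(2)[OF indep normal K]
  define L where "L w \<omega> = (\<Sum>k\<in>K. w k * \<epsilon> k \<omega>)" for w \<omega>
  define q where "q w = (\<Sum>k\<in>K. (w k)\<^sup>2)" for w :: "'i \<Rightarrow> real"
  define r where "r = (\<Sum>k\<in>K. u k * v k)"
  have L: "L (\<lambda>k. u k + v k) \<omega> = L u \<omega> + L v \<omega>" "L (\<lambda>k. u k - v k) \<omega> = L u \<omega> - L v \<omega>" for \<omega>
    by (simp_all add: L_def algebra_simps sum.distrib sum_subtractf)
  have q: "q (\<lambda>k. u k + v k) = q u + q v + 2 * r" "q (\<lambda>k. u k - v k) = q u + q v - 2 * r"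
    by (simp_all add: q_def r_def power2_sum power2_diff sum.distrib sum_subtractf sum_distrib_left mult.assoc)
  \<comment> \<open>The identity (x + y)^4 + (x - y)^4 - 2 x^4 - 2 y^4 = 12 x^2 y^2,
    applied to the forms and, through their variances, to the moments.\<close>
  have H: "has_bochner_integral M
      (\<lambda>\<omega>. ((L (\<lambda>k. u k + v k) \<omega>)^4 + (L (\<lambda>k. u k - v k) \<omega>)^4 - 2 * (L u \<omega>)^4 - 2 * (L v \<omega>)^4) / 12)
      ((3 * (q (\<lambda>k. u k + v k))\<^sup>2 + 3 * (q (\<lambda>k. u k - v k))\<^sup>2
         - 2 * (3 * (q u)\<^sup>2) - 2 * (3 * (q v)\<^sup>2)) / 12)"
    unfolding L_def q_def
    by (intro has_bochner_integral_diff has_bochner_integral_add has_bochner_integral_mult_right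
        has_bochner_integral_divide_zero m4)
  have e1: "(((x::real) + y)^4 + (x - y)^4 - 2 * x^4 - 2 * y^4) / 12 = x\<^sup>2 * y\<^sup>2" for x y
    by (simp add: power4_eq_xxxx power2_eq_square algebra_simps)
  have e2: "(3 * (q u + q v + 2 * r)\<^sup>2 + 3 * (q u + q v - 2 * r)\<^sup>2
         - 2 * (3 * (q u)\<^sup>2) - 2 * (3 * (q v)\<^sup>2)) / 12 = q u * q v + 2 * r\<^sup>2"
    by (simp add: power2_eq_square algebra_simps)
  show ?thesis
    using H unfolding L q e1 e2 unfolding L_def q_def r_def .
qed

text \<open>
  Subtracting the means from the product formula leaves twice the squared covariance for each pair.
\<close>

lemma gaussian_quadratic_form_variance:
  fixes \<epsilon> :: "'i \<Rightarrow> 'a \<Rightarrow> real" and u :: "'j \<Rightarrow> 'i \<Rightarrow> real"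
  assumes indep: "indep_vars (\<lambda>_. borel) \<epsilon> UNIV"
    and normal: "\<And>k. distributed M lborel (\<epsilon> k) std_normal_density"
    and K: "finite K"
  shows "has_bochner_integral M
      (\<lambda>\<omega>. (\<Sum>i\<in>J. (\<Sum>k\<in>K. u i k * \<epsilon> k \<omega>)\<^sup>2 - (\<Sum>k\<in>K. (u i k)\<^sup>2))\<^sup>2)
      (2 * (\<Sum>i\<in>J. \<Sum>j\<in>J. (\<Sum>k\<in>K. u i k * u j k)\<^sup>2))"
proof -
  define L where "L i \<omega> = (\<Sum>k\<in>K. u i k * \<epsilon> k \<omega>)" for i \<omega>
  define q where "q i = (\<Sum>k\<in>K. (u i k)\<^sup>2)" for i
  define r where "r i j = (\<Sum>k\<in>K. u i k * u j k)" for i j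
  have c: "has_bochner_integral M (\<lambda>_. b) b" for b :: real
    by (simp add: has_bochner_integral_iff prob_space)
  have pair: "has_bochner_integral M (\<lambda>\<omega>. ((L i \<omega>)\<^sup>2 - q i) * ((L j \<omega>)\<^sup>2 - q j)) (2 * (r i j)\<^sup>2)" for i j
  proof -
    have "has_bochner_integral M
        (\<lambda>\<omega>. (L i \<omega>)\<^sup>2 * (L j \<omega>)\<^sup>2 - q i * (L j \<omega>)\<^sup>2 - q j * (L i \<omega>)\<^sup>2 + q i * q j)
        ((q i * q j + 2 * (r i j)\<^sup>2) - q i * q j - q j * q i + q i * q j)"
      unfolding L_def
      unfolding q_def r_def
      by (intro has_bochner_integral_diff has_bochner_integral_add has_bochner_integral_mult_right c
          gaussian_sum_square_product[OF assms] gaussian_sum_moments(1)[OF assms])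
    then show ?thesis by (simp add: algebra_simps)
  qed
  have "has_bochner_integral M
      (\<lambda>\<omega>. \<Sum>i\<in>J. \<Sum>j\<in>J. ((L i \<omega>)\<^sup>2 - q i) * ((L j \<omega>)\<^sup>2 - q j))
      (\<Sum>i\<in>J. \<Sum>j\<in>J. 2 * (r i j)\<^sup>2)"
    by (intro has_bochner_integral_sum pair)
  moreover have "(\<Sum>i\<in>J. x i)\<^sup>2 = (\<Sum>i\<in>J. \<Sum>j\<in>J. x i * x j)" for x :: "'j \<Rightarrow> real"
    by (simp only: power2_eq_square sum_product)
  ultimately show ?thesis
    by (simp only: L_def q_def r_def sum_distrib_left)
qed

end

section \<open>Second moment of the block statistic of a linear process\<close>

definition autocov :: "(nat \<Rightarrow> real) \<Rightarrow> int \<Rightarrow> real" where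
  "autocov a k = (\<Sum>j. a j * a (j + nat \<bar>k\<bar>))"

text \<open>
  The covariance of two blocks of \<open>l\<close> consecutive residuals whose starting points differ by \<open>d\<close>; for
  \<open>d = 0\<close> it is the variance of a block. It is defined from the coefficients alone, so that its
  asymptotic analysis is deterministic.
\<close>

definition block_cov :: "(nat \<Rightarrow> real) \<Rightarrow> nat \<Rightarrow> int \<Rightarrow> real" where
  "block_cov a l d = (\<Sum>s\<in>{1..int l}. \<Sum>t\<in>{1..int l}. autocov a (d + s - t))"

text \<open>
  Extending the coefficients by zero turns the moving average into a convolution over all
  integers, so that several residuals can be written as sums over one common window of innovations.
\<close>

definition causal :: "(nat \<Rightarrow> real) \<Rightarrow> int \<Rightarrow> real" where
  "causal a x = (if 0 \<le> x then a (nat x) else 0)"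

lemma autocov_summable:
  fixes a :: "nat \<Rightarrow> real"
  assumes "summable (\<lambda>j. (a j)\<^sup>2)"
  shows "summable (\<lambda>j. a j * a (j + k))"
proof (rule summable_comparison_test')
  show "summable (\<lambda>j. (a j)\<^sup>2 + (a (j + k))\<^sup>2)"
    by (intro summable_add assms summable_ignore_initial_segment[of "\<lambda>j. (a j)\<^sup>2"])
  have "2 * (\<bar>x\<bar> * \<bar>y\<bar>) \<le> x\<^sup>2 + y\<^sup>2" for x y :: real
    using sum_squares_bound[of "\<bar>x\<bar>" "\<bar>y\<bar>"] by (simp add: mult.assoc)
  moreover have "0 \<le> \<bar>x\<bar> * \<bar>y\<bar>" for x y :: real by simp
  ultimately have "\<bar>x\<bar> * \<bar>y\<bar> \<le> x\<^sup>2 + y\<^sup>2" for x y :: real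
    by (smt (verit))
  then show "norm (a j * a (j + k)) \<le> (a j)\<^sup>2 + (a (j + k))\<^sup>2" for j
    by (simp add: abs_mult)
qed

lemma causal_window:
  fixes x :: "int \<Rightarrow> real"
  assumes "0 \<le> t" "t \<le> int n"
  shows "(\<Sum>k\<in>{-int m..int n}. causal a (t - k) * x k) = (\<Sum>j\<le>m + nat t. a j * x (t - int j))"
proof -
  have "(\<Sum>k\<in>{-int m..int n}. causal a (t - k) * x k) = (\<Sum>k\<in>{-int m..t}. causal a (t - k) * x k)"
    by (rule sum.mono_neutral_right) (use assms in \<open>auto simp: causal_def\<close>)
  also have "\<dots> = (\<Sum>j\<le>m + nat t. a j * x (t - int j))"
    by (rule sum.reindex_bij_witness[of _ "\<lambda>j. t - int j" "\<lambda>k. nat (t - k)"])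
      (use assms in \<open>auto simp: causal_def\<close>)
  finally show ?thesis .
qed

text \<open>
  Only innovations with index in \<open>[-m, n]\<close> are kept. Since the window is cut by the index of the
  innovation and not by the lag, every sum below is an initial segment of the series it approximates.
\<close>

lemma truncated_autocov_limit:
  fixes a :: "nat \<Rightarrow> real"
  assumes a: "summable (\<lambda>j. (a j)\<^sup>2)" and "s \<in> {0..int n}" "t \<in> {0..int n}"
  shows "(\<lambda>m. \<Sum>k\<in>{-int m..int n}. causal a (s - k) * causal a (t - k)) \<longlonglongrightarrow> autocov a (s - t)"
  using assms(2,3)
proof (induction s t rule: linorder_wlog)
  case (le s t)
  have "(\<lambda>m. \<Sum>j\<le>m + nat s. a j * a (j + nat \<bar>s - t\<bar>)) \<longlonglongrightarrow> autocov a (s - t)"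
    unfolding autocov_def
    by (rule LIMSEQ_ignore_initial_segment[OF summable_LIMSEQ'[OF autocov_summable[OF a]]])
  moreover have "causal a (t - (s - int j)) = a (j + nat \<bar>s - t\<bar>)" for j
    using le by (auto simp: causal_def intro!: arg_cong[of _ _ a])
  ultimately show ?case
    using le by (simp add: causal_window)
next
  case (sym s t)
  then show ?case by (simp add: mult.commute autocov_def abs_minus_commute)
qed

text \<open>
  The coefficient of the innovation with index \<open>k\<close> in the block sum over \<open>i + 1, \<dots>, i + l\<close>.
\<close>

definition block_coeff :: "(nat \<Rightarrow> real) \<Rightarrow> nat \<Rightarrow> int \<Rightarrow> int \<Rightarrow> real" where
  "block_coeff a l i k = (\<Sum>s\<in>{1..int l}. causal a (i + s - k))"

lemma truncated_block_cov_limit: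
  fixes a :: "nat \<Rightarrow> real"
  assumes a: "summable (\<lambda>j. (a j)\<^sup>2)"
    and i: "0 \<le> i" "i + int l \<le> int n" and j: "0 \<le> j" "j + int l \<le> int n"
  shows "(\<lambda>m. \<Sum>k\<in>{-int m..int n}. block_coeff a l i k * block_coeff a l j k) \<longlonglongrightarrow> block_cov a l (i - j)"
proof -
  have eq: "(\<Sum>k\<in>A. block_coeff a l i k * block_coeff a l j k) =
      (\<Sum>s\<in>{1..int l}. \<Sum>t\<in>{1..int l}. \<Sum>k\<in>A. causal a (i + s - k) * causal a (j + t - k))" for A
  proof -
    have "(\<Sum>k\<in>A. block_coeff a l i k * block_coeff a l j k) =
      (\<Sum>k\<in>A. \<Sum>s\<in>{1..int l}. \<Sum>t\<in>{1..int l}. causal a (i + s - k) * causal a (j + t - k))"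
      by (simp only: block_coeff_def sum_product)
    also have "\<dots> = (\<Sum>s\<in>{1..int l}. \<Sum>k\<in>A. \<Sum>t\<in>{1..int l}. causal a (i + s - k) * causal a (j + t - k))"
      by (rule sum.swap)
    also have "\<dots> = (\<Sum>s\<in>{1..int l}. \<Sum>t\<in>{1..int l}. \<Sum>k\<in>A. causal a (i + s - k) * causal a (j + t - k))"
      by (intro sum.cong refl sum.swap)
    finally show ?thesis .
  qed
  have lim: "block_cov a l (i - j) = (\<Sum>s\<in>{1..int l}. \<Sum>t\<in>{1..int l}. autocov a ((i + s) - (j + t)))"
    unfolding block_cov_def by (simp add: algebra_simps)
  show ?thesis
    unfolding eq lim
    by (intro tendsto_sum truncated_autocov_limit[OF a]) (use i j in auto)
qed

text \<open>
  For a finite window this is the inequality of Cauchy and Schwarz for the coefficient vectors of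
  two blocks; it survives the limit.
\<close>

lemma block_cov_le_variance:
  fixes a :: "nat \<Rightarrow> real"
  assumes a: "summable (\<lambda>j. (a j)\<^sup>2)" and d: "0 \<le> d"
  shows "(block_cov a l d)\<^sup>2 \<le> (block_cov a l 0)\<^sup>2"
proof -
  define n where "n = nat d + l"
  let ?T = "\<lambda>i j m. \<Sum>k\<in>{-int m..int n}. block_coeff a l i k * block_coeff a l j k"
  have n: "d + int l \<le> int n" using d by (simp add: n_def)
  note T = truncated_block_cov_limit[OF a]
  have "(\<lambda>m. (?T d 0 m)\<^sup>2) \<longlonglongrightarrow> (block_cov a l (d - 0))\<^sup>2"
    by (intro tendsto_power T) (use n d in auto)
  moreover have "(\<lambda>m. ?T d d m * ?T 0 0 m) \<longlonglongrightarrow> block_cov a l (d - d) * block_cov a l (0 - 0)"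
    by (intro tendsto_mult T) (use n d in auto)
  moreover have "(?T d 0 m)\<^sup>2 \<le> ?T d d m * ?T 0 0 m" for m
    using Cauchy_Schwarz_ineq_sum[of "block_coeff a l d" "block_coeff a l 0" "{-int m..int n}"]
    by (simp add: power2_eq_square)
  ultimately have "(block_cov a l (d - 0))\<^sup>2 \<le> block_cov a l (d - d) * block_cov a l (0 - 0)"
    by (intro LIMSEQ_le) auto
  then show ?thesis by (simp add: power2_eq_square)
qed

context prob_space
begin

text \<open>
  For a finite window of innovations the second moment is given exactly by the variance of a Gaussian
  quadratic form. The windowed statistic converges almost surely, hence Fatou's lemma bounds the second
  moment of the limit.
\<close>

lemma Qhat_second_moment:
  fixes \<epsilon> W :: "int \<Rightarrow> 'a \<Rightarrow> real" and a :: "nat \<Rightarrow> real"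
  assumes indep: "indep_vars (\<lambda>_. borel) \<epsilon> UNIV"
    and normal: "\<And>t. distributed M lborel (\<epsilon> t) std_normal_density"
    and series: "\<And>t. AE \<omega> in M. (\<lambda>j. a j * \<epsilon> (t - int j) \<omega>) sums W t \<omega>"
    and a: "summable (\<lambda>j. (a j)\<^sup>2)" and l: "l \<le> n"
  shows "(\<integral>\<^sup>+\<omega>. ennreal ((Qhat (\<lambda>t. W t \<omega>) n l - block_cov a l 0)\<^sup>2) \<partial>M) \<le>
      ennreal (2 / (real n - real l + 1)\<^sup>2 *
        (\<Sum>i\<in>{0..int n - int l}. \<Sum>j\<in>{0..int n - int l}. (block_cov a l (i - j))\<^sup>2))"
proof -
  define I where "I = {0..int n - int l}"
  define N where "N = real n - real l + 1"
  have N: "N > 0" "real (card I) = N" using l by (auto simp: N_def I_def)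
  define K where "K m = {-int m..int n}" for m :: nat
  have K: "finite (K m)" for m by (simp add: K_def)
  define T where "T m i \<omega> = (\<Sum>k\<in>K m. block_coeff a l i k * \<epsilon> k \<omega>)" for m i \<omega>
  define c where "c m i j = (\<Sum>k\<in>K m. block_coeff a l i k * block_coeff a l j k)" for m i j
  define F where "F m \<omega> = ((\<Sum>i\<in>I. (T m i \<omega>)\<^sup>2 - c m i i) / N)\<^sup>2" for m \<omega>
  have \<epsilon>_meas [measurable]: "\<epsilon> t \<in> borel_measurable M" for t
    using distributed_measurable[OF normal[of t]] by simp
  have F_meas [measurable]: "F m \<in> borel_measurable M" for m
    unfolding F_def T_def by measurable
  have Qhat: "Qhat w n l = (\<Sum>i\<in>I. (\<Sum>s\<in>{1..int l}. w (i + s))\<^sup>2) / N" for w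
  proof -
    have "(\<Sum>t = i + 1..i + int l. w t) = (\<Sum>s\<in>{1..int l}. w (i + s))" for i
      by (rule sum.reindex_bij_witness[of _ "\<lambda>s. i + s" "\<lambda>t. t - i"]) auto
    then show ?thesis by (simp add: Qhat_def I_def N_def)
  qed
  have c_lim: "(\<lambda>m. c m i j) \<longlonglongrightarrow> block_cov a l (i - j)" if "i \<in> I" "j \<in> I" for i j
    unfolding c_def K_def by (rule truncated_block_cov_limit[OF a]) (use that in \<open>auto simp: I_def\<close>)
  have "AE \<omega> in M. \<forall>t. (\<lambda>j. a j * \<epsilon> (t - int j) \<omega>) sums W t \<omega>"
    using series by (simp add: AE_all_countable)
  then have conv: "AE \<omega> in M. (\<lambda>m. ennreal (F m \<omega>)) \<longlonglongrightarrow>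
      ennreal ((Qhat (\<lambda>t. W t \<omega>) n l - block_cov a l 0)\<^sup>2)"
  proof eventually_elim
    case (elim \<omega>)
    have "(\<lambda>m. T m i \<omega>) \<longlonglongrightarrow> (\<Sum>s\<in>{1..int l}. W (i + s) \<omega>)" if i: "i \<in> I" for i
    proof -
      have "T m i \<omega> = (\<Sum>s\<in>{1..int l}. \<Sum>k\<in>K m. causal a (i + s - k) * \<epsilon> k \<omega>)" for m
        unfolding T_def block_coeff_def sum_distrib_right by (rule sum.swap)
      also have "\<dots> m = (\<Sum>s\<in>{1..int l}. \<Sum>j\<le>m + nat (i + s). a j * \<epsilon> (i + s - int j) \<omega>)" for m
        unfolding K_def by (intro sum.cong refl causal_window) (use i in \<open>auto simp: I_def\<close>)
      finally have T: "(\<lambda>m. T m i \<omega>) =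
          (\<lambda>m. \<Sum>s\<in>{1..int l}. \<Sum>j\<le>m + nat (i + s). a j * \<epsilon> (i + s - int j) \<omega>)" by blast
      have "(\<lambda>m. \<Sum>j\<le>m. a j * \<epsilon> (t - int j) \<omega>) \<longlonglongrightarrow> W t \<omega>" for t
        using elim by (simp add: sums_def_le)
      from LIMSEQ_ignore_initial_segment[OF this] show ?thesis
        unfolding T by (intro tendsto_sum)
    qed
    then have "(\<lambda>m. F m \<omega>) \<longlonglongrightarrow>
        ((\<Sum>i\<in>I. (\<Sum>s\<in>{1..int l}. W (i + s) \<omega>)\<^sup>2 - block_cov a l (i - i)) / N)\<^sup>2"
      unfolding F_def using N by (intro tendsto_intros c_lim) auto
    also have "(\<Sum>i\<in>I. (\<Sum>s\<in>{1..int l}. W (i + s) \<omega>)\<^sup>2 - block_cov a l (i - i)) / N =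
        Qhat (\<lambda>t. W t \<omega>) n l - block_cov a l 0"
      using N by (simp add: Qhat sum_subtractf diff_divide_distrib)
    finally show ?case by (rule tendsto_ennrealI)
  qed
  have EF: "(\<integral>\<^sup>+\<omega>. ennreal (F m \<omega>) \<partial>M) = ennreal (2 / N\<^sup>2 * (\<Sum>i\<in>I. \<Sum>j\<in>I. (c m i j)\<^sup>2))" for m
  proof -
    have "has_bochner_integral M (\<lambda>\<omega>. (\<Sum>i\<in>I. (T m i \<omega>)\<^sup>2 - c m i i)\<^sup>2) (2 * (\<Sum>i\<in>I. \<Sum>j\<in>I. (c m i j)\<^sup>2))"
      using gaussian_quadratic_form_variance[OF indep normal K, where J = I and u = "block_coeff a l"]
      unfolding T_def c_def power2_eq_square[of "block_coeff a l _ _"] .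
    then have "has_bochner_integral M (\<lambda>\<omega>. (\<Sum>i\<in>I. (T m i \<omega>)\<^sup>2 - c m i i)\<^sup>2 / N\<^sup>2)
        (2 * (\<Sum>i\<in>I. \<Sum>j\<in>I. (c m i j)\<^sup>2) / N\<^sup>2)"
      by (rule has_bochner_integral_divide_zero)
    then have "has_bochner_integral M (F m) (2 / N\<^sup>2 * (\<Sum>i\<in>I. \<Sum>j\<in>I. (c m i j)\<^sup>2))"
      unfolding F_def power_divide by simp
    moreover have "0 \<le> F m \<omega>" for \<omega> by (simp add: F_def)
    ultimately show ?thesis
      by (simp add: nn_integral_eq_integral has_bochner_integral_iff)
  qed
  have "(\<integral>\<^sup>+\<omega>. ennreal ((Qhat (\<lambda>t. W t \<omega>) n l - block_cov a l 0)\<^sup>2) \<partial>M) =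
      (\<integral>\<^sup>+\<omega>. liminf (\<lambda>m. ennreal (F m \<omega>)) \<partial>M)"
    by (intro nn_integral_cong_AE) (use conv in \<open>auto simp: lim_imp_Liminf\<close>)
  also have "\<dots> \<le> liminf (\<lambda>m. \<integral>\<^sup>+\<omega>. ennreal (F m \<omega>) \<partial>M)"
    by (rule nn_integral_liminf) simp
  also have "\<dots> = ennreal (2 / N\<^sup>2 * (\<Sum>i\<in>I. \<Sum>j\<in>I. (block_cov a l (i - j))\<^sup>2))"
    unfolding EF by (intro lim_imp_Liminf tendsto_ennrealI tendsto_intros c_lim) auto
  finally show ?thesis unfolding N_def I_def .
qed

end

section \<open>Sums of powers\<close>

text \<open>
  The mean value theorem on \<open>[x, x + 1]\<close>; it makes both power sum bounds below telescope.
\<close>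

lemma powr_increment:
  fixes x q :: real
  assumes "0 < x"
  obtains z where "x < z" "z < x + 1" "(x + 1) powr q - x powr q = q * z powr (q - 1)"
proof -
  have "\<exists>z>x. z < x + 1 \<and> (x + 1) powr q - x powr q = (x + 1 - x) * (q * z powr (q - 1))"
  proof (rule MVT2)
    show "((\<lambda>x. x powr q) has_real_derivative q * y powr (q - 1)) (at y)" if "x \<le> y" for y
      using that assms by (auto intro!: derivative_eq_intros)
  qed simp
  then show ?thesis using that by auto
qed

lemma sum_powr_le:
  assumes "0 \<le> p" "p < 1"
  shows "(\<Sum>j<n. real (Suc j) powr (- p)) \<le> real n powr (1 - p) / (1 - p)"
proof (induction n)
  case (Suc n)
  have "(1 - p) * real (Suc n) powr (- p) \<le> real (Suc n) powr (1 - p) - real n powr (1 - p)"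
  proof (cases "n = 0")
    case False
    then obtain z where z: "real n < z" "z < real n + 1"
      "(real n + 1) powr (1 - p) - real n powr (1 - p) = (1 - p) * z powr (1 - p - 1)"
      using powr_increment[of "real n" "1 - p"] by auto
    have "(real n + 1) powr (- p) \<le> z powr (- p)"
      by (rule powr_mono2') (use z assms in auto)
    then show ?thesis using z(3) assms by (simp add: add.commute mult_left_mono)
  qed (use assms in auto)
  then have "real (Suc n) powr (- p) \<le> (real (Suc n) powr (1 - p) - real n powr (1 - p)) / (1 - p)"
    using assms by (simp add: pos_le_divide_eq mult.commute)
  then show ?case using Suc by (simp add: diff_divide_distrib)
qed simp

lemma sum_powr_tail_le:
  assumes "q > 1" "1 \<le> k" "k \<le> n"
  shows "(\<Sum>j\<in>{k..<n}. real (Suc j) powr (- q)) \<le> (real k powr (1 - q) - real n powr (1 - q)) / (q - 1)"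
  using assms(3)
proof (induction n rule: dec_induct)
  case (step n)
  then obtain z where z: "real n < z" "z < real n + 1"
    "(real n + 1) powr (1 - q) - real n powr (1 - q) = (1 - q) * z powr (1 - q - 1)"
    using powr_increment[of "real n" "1 - q"] assms by auto
  have "(real n + 1) powr (- q) \<le> z powr (- q)"
    by (rule powr_mono2') (use z assms in auto)
  then have "(q - 1) * real (Suc n) powr (- q) \<le> (q - 1) * z powr (- q)"
    using assms by (simp add: add.commute mult_left_mono)
  also have "\<dots> = real n powr (1 - q) - real (Suc n) powr (1 - q)"
    using z(3) by (simp add: algebra_simps)
  finally have "real (Suc n) powr (- q) \<le> (real n powr (1 - q) - real (Suc n) powr (1 - q)) / (q - 1)"
    using assms by (simp add: pos_le_divide_eq mult.commute)
  then show ?case using step by (simp add: diff_divide_distrib)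
qed (use assms in auto)

lemma power_convolution_summable:
  assumes "0 \<le> q" "p + q > 1"
  shows "summable (\<lambda>j. real (Suc j) powr (- p) * real (Suc j + k) powr (- q))"
proof (rule summable_comparison_test')
  have "summable (\<lambda>j. real j powr (- (p + q)))"
    using assms by (simp add: summable_real_powr_iff)
  then show "summable (\<lambda>j. real (Suc j) powr (- (p + q)))"
    by (subst (asm) summable_Suc_iff[symmetric])
  fix j
  have "real (Suc j + k) powr (- q) \<le> real (Suc j) powr (- q)"
    by (rule powr_mono2') (use assms in auto)
  then have "real (Suc j) powr (- p) * real (Suc j + k) powr (- q)
      \<le> real (Suc j) powr (- p) * real (Suc j) powr (- q)"
    by (rule mult_left_mono) simp
  then show "norm (real (Suc j) powr (- p) * real (Suc j + k) powr (- q)) \<le> real (Suc j) powr (- (p + q))"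
    by (simp add: powr_add[symmetric])
qed

text \<open>
  The sum is split at \<open>j = k\<close>. Below, \<open>j + k\<close> is comparable to \<open>k\<close> and \<open>p < 1\<close> makes the sum of
  \<open>j powr (- p)\<close> grow like \<open>k powr (1 - p)\<close>; above, \<open>j + k\<close> is comparable to \<open>j\<close> and \<open>p + q > 1\<close> makes the
  tail decay. Both parts have order \<open>k powr (1 - p - q)\<close>.
\<close>

lemma power_convolution_le:
  assumes "0 \<le> p" "p < 1" "0 \<le> q" "p + q > 1" "1 \<le> k"
  shows "(\<Sum>j. real (Suc j) powr (- p) * real (Suc j + k) powr (- q))
    \<le> (1 / (1 - p) + 1 / (p + q - 1)) * real k powr (1 - p - q)"
proof (rule suminf_le_const[OF power_convolution_summable])
  fix n
  let ?t = "\<lambda>j. real (Suc j) powr (- p) * real (Suc j + k) powr (- q)"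
  have "(\<Sum>j<n. ?t j) \<le> (\<Sum>j<max n k. ?t j)"
    by (rule sum_mono2) auto
  also have "\<dots> = (\<Sum>j<k. ?t j) + (\<Sum>j\<in>{k..<max n k}. ?t j)"
    by (subst sum.union_disjoint[symmetric]) (auto intro!: sum.cong)
  also have "(\<Sum>j<k. ?t j) \<le> (\<Sum>j<k. real (Suc j) powr (- p) * real k powr (- q))"
    by (intro sum_mono mult_left_mono powr_mono2') (use assms in auto)
  also have "\<dots> \<le> real k powr (1 - p) / (1 - p) * real k powr (- q)"
    unfolding sum_distrib_right[symmetric]
    by (intro mult_right_mono sum_powr_le) (use assms in auto)
  also have "\<dots> = real k powr (1 - p - q) / (1 - p)"
    by (simp add: powr_add[symmetric])
  also have "(\<Sum>j\<in>{k..<max n k}. ?t j) \<le> (\<Sum>j\<in>{k..<max n k}. real (Suc j) powr (- (p + q)))"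
  proof (rule sum_mono)
    fix j
    have "?t j \<le> real (Suc j) powr (- p) * real (Suc j) powr (- q)"
      by (intro mult_left_mono powr_mono2') (use assms in auto)
    then show "?t j \<le> real (Suc j) powr (- (p + q))" by (simp add: powr_add[symmetric])
  qed
  also have "\<dots> \<le> (real k powr (1 - (p + q)) - real (max n k) powr (1 - (p + q))) / (p + q - 1)"
    by (rule sum_powr_tail_le) (use assms in auto)
  also have "\<dots> \<le> real k powr (1 - p - q) / (p + q - 1)"
    using assms by (simp add: divide_right_mono algebra_simps)
  finally show "(\<Sum>j<n. ?t j) \<le> (1 / (1 - p) + 1 / (p + q - 1)) * real k powr (1 - p - q)"
    by (simp add: algebra_simps)
qed (use assms in auto)

text \<open>
  For a fixed \<open>s\<close> every distance \<open>\<bar>s - t\<bar>\<close> occurs at most twice, once on each side of \<open>s\<close>.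
\<close>

lemma sum_abs_diff_le:
  fixes g :: "nat \<Rightarrow> real"
  assumes g: "\<And>d. 0 \<le> g d"
  shows "(\<Sum>s\<in>{x..y}. \<Sum>t\<in>{x..y}. g (nat \<bar>s - t\<bar>)) \<le> 2 * real (card {x..y}) * (\<Sum>d<card {x..y}. g d)"
proof -
  have "(\<Sum>t\<in>{x..y}. g (nat \<bar>s - t\<bar>)) \<le> 2 * (\<Sum>d<card {x..y}. g d)" if s: "s \<in> {x..y}" for s
  proof -
    \<comment> \<open>On either side of s the distance determines t.\<close>
    have half: "(\<Sum>t\<in>A. g (nat \<bar>s - t\<bar>)) \<le> (\<Sum>d<card {x..y}. g d)"
      if "A \<subseteq> {x..y}" "inj_on (\<lambda>t. nat \<bar>s - t\<bar>) A" for A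
    proof -
      have "(\<Sum>t\<in>A. g (nat \<bar>s - t\<bar>)) = (\<Sum>d\<in>(\<lambda>t. nat \<bar>s - t\<bar>) ` A. g d)"
        using that by (simp add: sum.reindex)
      also have "\<dots> \<le> (\<Sum>d<card {x..y}. g d)"
      proof (rule sum_mono2)
        show "(\<lambda>t. nat \<bar>s - t\<bar>) ` A \<subseteq> {..<card {x..y}}"
        proof clarify
          fix t assume "t \<in> A"
          then have "x \<le> t" "t \<le> y" using that(1) by auto
          then show "nat \<bar>s - t\<bar> < card {x..y}" using s by auto
        qed
      qed (use g in auto)
      finally show ?thesis .
    qed
    have "(\<Sum>t\<in>{x..y}. g (nat \<bar>s - t\<bar>)) = (\<Sum>t\<in>{x..s} \<union> {s<..y}. g (nat \<bar>s - t\<bar>))"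
      using s by (intro sum.cong) auto
    also have "\<dots> = (\<Sum>t\<in>{x..s}. g (nat \<bar>s - t\<bar>)) + (\<Sum>t\<in>{s<..y}. g (nat \<bar>s - t\<bar>))"
      by (rule sum.union_disjoint) auto
    also have "\<dots> \<le> (\<Sum>d<card {x..y}. g d) + (\<Sum>d<card {x..y}. g d)"
      by (intro add_mono half) (use s in \<open>auto simp: inj_on_def\<close>)
    finally show ?thesis by simp
  qed
  then have "(\<Sum>s\<in>{x..y}. \<Sum>t\<in>{x..y}. g (nat \<bar>s - t\<bar>)) \<le> (\<Sum>s\<in>{x..y}. 2 * (\<Sum>d<card {x..y}. g d))"
    by (rule sum_mono)
  then show ?thesis by (simp add: mult_ac)
qed

lemma double_sum_powr_bound:
  fixes x :: "nat \<Rightarrow> real"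
  assumes x: "\<And>d. \<bar>x d\<bar> \<le> K * real (Suc d) powr (- p)" and p: "0 \<le> p" "p < 1"
  shows "\<bar>\<Sum>s\<in>{1..int l}. \<Sum>t\<in>{1..int l}. x (nat \<bar>s - t\<bar>)\<bar> \<le> 2 * K / (1 - p) * real l powr (2 - p)"
proof -
  have K: "0 \<le> K" using x[of 0] by simp
  have "\<bar>\<Sum>s\<in>{1..int l}. \<Sum>t\<in>{1..int l}. x (nat \<bar>s - t\<bar>)\<bar>
      \<le> (\<Sum>s\<in>{1..int l}. \<Sum>t\<in>{1..int l}. K * real (Suc (nat \<bar>s - t\<bar>)) powr (- p))"
    by (intro order_trans[OF sum_abs] sum_mono x)
  also have "\<dots> \<le> 2 * real l * (\<Sum>d<l. K * real (Suc d) powr (- p))"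
    using sum_abs_diff_le[of "\<lambda>d. K * real (Suc d) powr (- p)" 1 "int l"] K by simp
  also have "\<dots> \<le> 2 * real l * (K * (real l powr (1 - p) / (1 - p)))"
    unfolding sum_distrib_left[symmetric]
    by (intro mult_left_mono sum_powr_le) (use p K in auto)
  also have "\<dots> = 2 * K / (1 - p) * (real l * real l powr (1 - p))"
    by simp
  also have "\<dots> = 2 * K / (1 - p) * real l powr (2 - p)"
    by (simp add: powr_mult_base)
  finally show ?thesis .
qed

text \<open>
  Passing from \<open>d\<close> to \<open>Suc d\<close> costs a factor 2 and allows \<open>d = 0\<close>, where \<open>real d powr (- p) = 0\<close>. This is
  how the diagonal terms of a double sum over a block are covered by the same bound as the others.
\<close>

lemma shift_power_bound:
  fixes x :: "nat \<Rightarrow> real"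
  assumes x: "\<And>d. 1 \<le> d \<Longrightarrow> \<bar>x d\<bar> \<le> K * real d powr (- p)" and p: "0 \<le> p" "p \<le> 1" and K: "0 \<le> K"
  shows "\<bar>x d\<bar> \<le> (\<bar>x 0\<bar> + 2 * K) * real (Suc d) powr (- p)"
proof (cases "d = 0")
  case False
  have "real d powr (- p) = 2 powr p * (2 * real d) powr (- p)"
    by (simp add: powr_mult powr_minus)
  also have "\<dots> \<le> 2 powr 1 * real (Suc d) powr (- p)"
    by (intro mult_mono powr_mono powr_mono2') (use p False in auto)
  finally have "K * real d powr (- p) \<le> K * (2 * real (Suc d) powr (- p))"
    using K by (simp add: mult_left_mono)
  then have "\<bar>x d\<bar> \<le> K * (2 * real (Suc d) powr (- p))"
    using x[of d] False by linarith
  also have "\<dots> \<le> (\<bar>x 0\<bar> + 2 * K) * real (Suc d) powr (- p)"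
    by (simp add: algebra_simps)
  finally show ?thesis .
qed (use K in simp)

section \<open>Autocovariance of an exact power law\<close>

text \<open>
  The autocovariance at lag \<open>k\<close> of the moving average with coefficients \<open>j powr (- b)\<close>, \<open>j \<ge> 1\<close>.
\<close>

definition power_corr :: "real \<Rightarrow> nat \<Rightarrow> real" where
  "power_corr b k = (\<Sum>j. real (Suc j) powr (- b) * real (Suc j + k) powr (- b))"

context
  fixes b :: real
  assumes b: "1 / 2 < b" "b < 1"
begin

lemma power_corr_summable: "summable (\<lambda>j. real (Suc j) powr (- b) * real (Suc j + k) powr (- b))"
  by (rule power_convolution_summable) (use b in auto)

lemma power_corr_nonneg: "0 \<le> power_corr b k"
  unfolding power_corr_def by (rule suminf_nonneg[OF power_corr_summable]) simp

lemma power_corr_antimono: "k \<le> k' \<Longrightarrow> power_corr b k' \<le> power_corr b k"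
  unfolding power_corr_def
  by (intro suminf_le power_corr_summable mult_left_mono powr_mono2') (use b in auto)

lemma power_corr_upper:
  assumes "1 \<le> k"
  shows "power_corr b k \<le> (1 / (1 - b) + 1 / (2 * b - 1)) * real k powr (1 - 2 * b)"
proof -
  have "b + b - 1 = 2 * b - 1" "1 - b - b = 1 - 2 * b" by auto
  then show ?thesis
    unfolding power_corr_def using power_convolution_le[of b b k] b assms by simp
qed

lemma power_corr_lower:
  assumes "1 \<le> k"
  shows "2 powr (- b) * real k powr (1 - 2 * b) \<le> power_corr b k"
proof -
  have "2 powr (- b) * real k powr (1 - 2 * b) = (\<Sum>j<k. real k powr (- b) * (2 * real k) powr (- b))"
    using assms by (simp add: powr_mult powr_mult_base powr_add[symmetric])
  also have "\<dots> \<le> (\<Sum>j<k. real (Suc j) powr (- b) * real (Suc j + k) powr (- b))"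
    by (intro sum_mono mult_mono powr_mono2') (use b in auto)
  also have "\<dots> \<le> power_corr b k"
    unfolding power_corr_def by (rule sum_le_suminf[OF power_corr_summable]) auto
  finally show ?thesis .
qed

text \<open>
  Each factor satisfies \<open>(m / (m + 1)) powr b \<ge> m / (m + 1)\<close> as \<open>b \<le> 1\<close>, so every term of the series
  loses at most the fraction \<open>1 / (k + 1)\<close> of its value when the lag increases by one.
\<close>

lemma power_corr_step: "power_corr b k - power_corr b (Suc k) \<le> power_corr b k / real (Suc k)"
proof -
  have "power_corr b k - power_corr b (Suc k) =
      (\<Sum>j. real (Suc j) powr (- b) * real (Suc j + k) powr (- b)
        - real (Suc j) powr (- b) * real (Suc j + Suc k) powr (- b))"
    unfolding power_corr_def by (rule suminf_diff[OF power_corr_summable power_corr_summable])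
  also have "\<dots> \<le> (\<Sum>j. real (Suc j) powr (- b) * real (Suc j + k) powr (- b) / real (Suc k))"
  proof (rule suminf_le)
    fix j
    define m where "m = real (Suc j + k)"
    have m: "m \<ge> 1" "real (Suc k) \<le> m + 1" "real (Suc j + Suc k) = m + 1" by (auto simp: m_def)
    have "(m / (m + 1)) powr 1 \<le> (m / (m + 1)) powr b"
      by (rule powr_mono') (use b m in auto)
    then have "m powr (- b) * (m / (m + 1)) \<le> m powr (- b) * (m / (m + 1)) powr b"
      by (intro mult_left_mono) (use m \<open>(m / (m + 1)) powr 1 \<le> _\<close> in auto)
    also have "\<dots> = (m + 1) powr (- b)"
      using m by (simp add: powr_divide powr_minus field_simps)
    finally have "m powr (- b) - (m + 1) powr (- b) \<le> m powr (- b) / (m + 1)"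
      using m by (simp add: field_simps)
    also have "\<dots> \<le> m powr (- b) / real (Suc k)"
      by (rule divide_left_mono) (use m in auto)
    finally have "real (Suc j) powr (- b) * (m powr (- b) - (m + 1) powr (- b))
        \<le> real (Suc j) powr (- b) * (m powr (- b) / real (Suc k))"
      by (rule mult_left_mono) simp
    then show "real (Suc j) powr (- b) * real (Suc j + k) powr (- b)
        - real (Suc j) powr (- b) * real (Suc j + Suc k) powr (- b)
        \<le> real (Suc j) powr (- b) * real (Suc j + k) powr (- b) / real (Suc k)"
      unfolding m(3) m_def[symmetric] by (simp add: right_diff_distrib)
  qed (intro summable_diff summable_divide power_corr_summable)+
  also have "\<dots> = power_corr b k / real (Suc k)"
    unfolding power_corr_def by (rule suminf_divide[OF power_corr_summable])
  finally show ?thesis .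
qed

text \<open>
  The terms of the series at lag \<open>2 * k\<close> decrease, and the term with an even index \<open>2 * i\<close> is
  \<open>2 powr (- 2 * b)\<close> times the term with index \<open>i\<close> at lag \<open>k\<close>. Pairing each even term with its left
  neighbour bounds the series from below by twice its even terms. Pairing it with its right
  neighbour bounds the series from above, at the price of the first term, which is left over.
\<close>

lemma power_corr_double:
  assumes "1 \<le> k"
  shows "2 powr (1 - 2 * b) * power_corr b k \<le> power_corr b (2 * k)"
    and "power_corr b (2 * k) \<le> 2 powr (1 - 2 * b) * power_corr b k + real k powr (- b)"
proof -
  define x where "x i = real i powr (- b) * real (i + 2 * k) powr (- b)" for i
  have x_mono: "x j \<le> x i" if "1 \<le> i" "i \<le> j" for i j
    unfolding x_def by (intro mult_mono powr_mono2') (use that b in auto)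
  have sx: "summable (\<lambda>j. x (Suc j))"
    unfolding x_def by (rule power_corr_summable)
  have even: "2 powr (1 - 2 * b) * (real (Suc i) powr (- b) * real (Suc i + k) powr (- b)) = 2 * x (2 * i + 2)" for i
  proof -
    have "x (2 * i + 2) = (2 * real (Suc i)) powr (- b) * (2 * real (Suc i + k)) powr (- b)"
      unfolding x_def by (simp add: algebra_simps)
    also have "\<dots> = (2 powr (- b) * 2 powr (- b)) * (real (Suc i) powr (- b) * real (Suc i + k) powr (- b))"
      unfolding powr_mult by (simp only: mult_ac)
    also have "2 powr (- b) * 2 powr (- b) = 2 powr (1 - 2 * b) / (2::real)"
      by (simp add: powr_add[symmetric] powr_diff powr_minus_divide)
    finally show ?thesis by simp
  qed
  have E: "(\<lambda>i. 2 * x (2 * i + 2)) sums (2 powr (1 - 2 * b) * power_corr b k)"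
    unfolding even[symmetric] power_corr_def by (intro sums_mult summable_sums power_corr_summable)
  have tot: "(\<lambda>j. x (Suc j)) sums power_corr b (2 * k)"
    unfolding x_def power_corr_def by (intro summable_sums power_corr_summable)
  have "(\<lambda>n. sum (\<lambda>j. x (Suc j)) {n * 2..<n * 2 + 2}) sums power_corr b (2 * k)"
    by (rule sums_group[OF tot]) simp
  moreover have "sum (\<lambda>j. x (Suc j)) {n * 2..<n * 2 + 2} = x (2 * n + 1) + x (2 * n + 2)" for n
    by (simp add: mult.commute numeral_2_eq_2)
  ultimately have A: "(\<lambda>n. x (2 * n + 1) + x (2 * n + 2)) sums power_corr b (2 * k)" by simp
  show "2 powr (1 - 2 * b) * power_corr b k \<le> power_corr b (2 * k)"
  proof (rule sums_le[OF _ E A])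
    show "2 * x (2 * n + 2) \<le> x (2 * n + 1) + x (2 * n + 2)" for n
      using x_mono[of "2 * n + 1" "2 * n + 2"] by simp
  qed
  have "(\<lambda>j. x (Suc (Suc j))) sums (power_corr b (2 * k) - x 1)"
    using tot sums_Suc_iff[of "\<lambda>j. x (Suc j)"] by simp
  from sums_group[OF this, of 2]
  have "(\<lambda>n. sum (\<lambda>j. x (Suc (Suc j))) {n * 2..<n * 2 + 2}) sums (power_corr b (2 * k) - x 1)"
    by simp
  moreover have "sum (\<lambda>j. x (Suc (Suc j))) {n * 2..<n * 2 + 2} = x (2 * n + 2) + x (2 * n + 3)" for n
    by (simp add: mult.commute numeral_2_eq_2 numeral_3_eq_3)
  ultimately have B: "(\<lambda>n. x (2 * n + 2) + x (2 * n + 3)) sums (power_corr b (2 * k) - x 1)" by simp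
  have "power_corr b (2 * k) - x 1 \<le> 2 powr (1 - 2 * b) * power_corr b k"
  proof (rule sums_le[OF _ B E])
    show "x (2 * n + 2) + x (2 * n + 3) \<le> 2 * x (2 * n + 2)" for n
      using x_mono[of "2 * n + 2" "2 * n + 3"] by simp
  qed
  moreover have "x 1 \<le> real k powr (- b)"
    unfolding x_def by (simp, rule powr_mono2') (use b assms in auto)
  ultimately show "power_corr b (2 * k) \<le> 2 powr (1 - 2 * b) * power_corr b k + real k powr (- b)"
    by linarith
qed

end

section \<open>Block variances under doubling\<close>

lemma sum_split_parity:
  fixes G :: "int \<Rightarrow> real"
  shows "(\<Sum>s\<in>{1..int (2 * l)}. G s) = (\<Sum>s\<in>{1..int l}. G (2 * s - 1) + G (2 * s))"
proof (induction l)
  case (Suc l)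
  have "{1..int (2 * Suc l)} = insert (2 * int l + 2) (insert (2 * int l + 1) {1..int (2 * l)})"
    by auto
  moreover have "{1..int (Suc l)} = insert (int l + 1) {1..int l}"
    by auto
  ultimately show ?case
    using Suc by (simp add: algebra_simps)
qed simp

text \<open>
  The coefficients are an exact power law from index 1 on, up to a relative error \<open>j powr (- \<delta>)\<close>. The
  condition \<open>\<delta> < 1 - b\<close> reflects a barrier: finitely many arbitrary coefficients, \<open>a 0\<close> among them,
  perturb the autocovariance at lag \<open>k\<close> by \<open>O(k powr (- b))\<close>, which relative to its size
  \<open>k powr (1 - 2 * b)\<close> is \<open>k powr (- (1 - b))\<close>. It also keeps the exponent \<open>b + \<delta>\<close> of the error below 1,
  so that no logarithms appear.
\<close>

locale power_law_coefficients =
  fixes a :: "nat \<Rightarrow> real" and b c \<delta> K :: real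
  assumes b: "1 / 2 < b" "b < 1" and \<delta>: "0 < \<delta>" "\<delta> < 1 - b" and c: "0 < c"
    and coeff: "\<And>j. \<bar>a (Suc j) - c * real (Suc j) powr (- b)\<bar> \<le> K * real (Suc j) powr (- b - \<delta>)"
begin

text \<open>
  The order of the autocovariance error: the exponent \<open>2 * b - 1\<close> of the autocovariance itself,
  improved by \<open>\<delta>\<close>.
\<close>

definition decay :: real where "decay = 2 * b - 1 + \<delta>"

lemma decay: "0 < decay" "decay < 1" "decay \<le> b" "decay \<le> 2 * b"
  using b \<delta> by (auto simp: decay_def)

lemma K_nonneg: "0 \<le> K"
  using coeff[of 0] by simp

lemma coeff_le: "\<bar>a (Suc j)\<bar> \<le> (c + K) * real (Suc j) powr (- b)"
proof -
  have "real (Suc j) powr (- b - \<delta>) \<le> real (Suc j) powr (- b)"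
    by (rule powr_mono) (use \<delta> in auto)
  then have "K * real (Suc j) powr (- b - \<delta>) \<le> K * real (Suc j) powr (- b)"
    using K_nonneg by (rule mult_left_mono)
  moreover have "\<bar>c * real (Suc j) powr (- b)\<bar> = c * real (Suc j) powr (- b)"
    using c by simp
  ultimately show ?thesis
    using coeff[of j] unfolding distrib_right by linarith
qed

lemma coeff_square_summable: "summable (\<lambda>j. (a j)\<^sup>2)"
proof (subst summable_Suc_iff[symmetric], rule summable_comparison_test')
  show "summable (\<lambda>j. (c + K)\<^sup>2 * (real (Suc j) powr (- b) * real (Suc j + 0) powr (- b)))"
    by (intro summable_mult power_corr_summable b)
  show "norm ((a (Suc j))\<^sup>2) \<le> (c + K)\<^sup>2 * (real (Suc j) powr (- b) * real (Suc j + 0) powr (- b))" for j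
    using power_mono[OF coeff_le[of j], of 2] by (simp add: power2_eq_square mult_ac)
qed

text \<open>
  The error of the second factor decays in \<open>j + k\<close>, hence at least as fast as in \<open>j\<close>. Charging both
  errors to the first factor leaves a single convolution of powers.
\<close>

lemma product_error:
  "\<bar>a (Suc j) * a (Suc j + k) - c\<^sup>2 * (real (Suc j) powr (- b) * real (Suc j + k) powr (- b))\<bar>
    \<le> (2 * c + K) * K * (real (Suc j) powr (- (b + \<delta>)) * real (Suc j + k) powr (- b))"
proof -
  define x y where "x = real (Suc j)" and "y = real (Suc j + k)"
  have xy: "1 \<le> x" "x \<le> y" by (auto simp: x_def y_def)
  have ex: "\<bar>a (Suc j) - c * x powr (- b)\<bar> \<le> K * x powr (- b - \<delta>)"
    unfolding x_def by (rule coeff)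
  have ey: "\<bar>a (Suc j + k) - c * y powr (- b)\<bar> \<le> K * y powr (- b - \<delta>)"
    using coeff[of "j + k"] by (simp add: y_def)
  have by': "\<bar>a (Suc j + k)\<bar> \<le> (c + K) * y powr (- b)"
    using coeff_le[of "j + k"] by (simp add: y_def)
  have "x powr (- b) * y powr (- b - \<delta>) = x powr (- b) * y powr (- b) * y powr (- \<delta>)"
    by (simp add: powr_diff powr_minus_divide)
  also have "\<dots> \<le> x powr (- b) * y powr (- b) * x powr (- \<delta>)"
    by (intro mult_left_mono powr_mono2') (use xy \<delta> in auto)
  also have "\<dots> = x powr (- b - \<delta>) * y powr (- b)"
    by (simp add: powr_diff powr_minus_divide)
  finally have sw: "x powr (- b) * y powr (- b - \<delta>) \<le> x powr (- b - \<delta>) * y powr (- b)" .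
  have "a (Suc j) * a (Suc j + k) - c\<^sup>2 * (x powr (- b) * y powr (- b)) =
      (a (Suc j) - c * x powr (- b)) * a (Suc j + k) + c * x powr (- b) * (a (Suc j + k) - c * y powr (- b))"
    by (simp add: algebra_simps power2_eq_square)
  also have "\<bar>\<dots>\<bar> \<le> \<bar>a (Suc j) - c * x powr (- b)\<bar> * \<bar>a (Suc j + k)\<bar>
      + c * x powr (- b) * \<bar>a (Suc j + k) - c * y powr (- b)\<bar>"
    using c by (intro order_trans[OF abs_triangle_ineq]) (simp add: abs_mult)
  also have "\<dots> \<le> (K * x powr (- b - \<delta>)) * ((c + K) * y powr (- b))
      + c * x powr (- b) * (K * y powr (- b - \<delta>))"
    using c K_nonneg by (intro add_mono mult_mono ex by' mult_left_mono ey) auto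
  also have "c * x powr (- b) * (K * y powr (- b - \<delta>)) = c * K * (x powr (- b) * y powr (- b - \<delta>))"
    by simp
  also have "\<dots> \<le> c * K * (x powr (- b - \<delta>) * y powr (- b))"
    using c K_nonneg by (intro mult_left_mono sw) auto
  finally have "\<bar>a (Suc j) * a (Suc j + k) - c\<^sup>2 * (x powr (- b) * y powr (- b))\<bar>
      \<le> (2 * c + K) * K * (x powr (- b - \<delta>) * y powr (- b))"
    by (simp add: algebra_simps)
  moreover have e: "- (b + \<delta>) = - b - \<delta>" by simp
  ultimately show ?thesis
    unfolding x_def y_def e by (simp only: of_nat_add)
qed

lemma autocov_approx_pos:
  obtains K1 where "0 \<le> K1"
    "\<And>k. 1 \<le> k \<Longrightarrow> \<bar>autocov a (int k) - c\<^sup>2 * power_corr b k\<bar> \<le> K1 * real k powr (- decay)"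
proof
  define C where "C = 1 / (1 - (b + \<delta>)) + 1 / (b + \<delta> + b - 1)"
  have C: "0 \<le> C" using b \<delta> by (simp add: C_def)
  show "0 \<le> \<bar>a 0\<bar> * (c + K) + (2 * c + K) * K * C"
    using c K_nonneg C by simp
  fix k :: nat assume k: "1 \<le> k"
  let ?e = "\<lambda>j. real (Suc j) powr (- (b + \<delta>)) * real (Suc j + k) powr (- b)"
  let ?f = "\<lambda>j. real (Suc j) powr (- b) * real (Suc j + k) powr (- b)"
  have sa: "summable (\<lambda>j. a (Suc j) * a (Suc j + k))"
    using autocov_summable[OF coeff_square_summable, of k] by (subst summable_Suc_iff)
  have se: "summable ?e"
    by (rule power_convolution_summable) (use b \<delta> in auto)
  have sf: "summable ?f" by (rule power_corr_summable[OF b])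
  have "autocov a (int k) = a 0 * a k + (\<Sum>j. a (Suc j) * a (Suc j + k))"
    unfolding autocov_def using suminf_split_head[OF autocov_summable[OF coeff_square_summable, of k]]
    by simp
  moreover have "(\<Sum>j. a (Suc j) * a (Suc j + k) - c\<^sup>2 * ?f j) = (\<Sum>j. a (Suc j) * a (Suc j + k)) - c\<^sup>2 * power_corr b k"
  proof (rule sums_unique[symmetric])
    have "?f sums power_corr b k"
      unfolding power_corr_def by (rule summable_sums[OF sf])
    from sums_diff[OF summable_sums[OF sa] sums_mult[OF this]]
    show "(\<lambda>j. a (Suc j) * a (Suc j + k) - c\<^sup>2 * ?f j) sums ((\<Sum>j. a (Suc j) * a (Suc j + k)) - c\<^sup>2 * power_corr b k)" .
  qed
  ultimately have "autocov a (int k) - c\<^sup>2 * power_corr b k = a 0 * a k + (\<Sum>j. a (Suc j) * a (Suc j + k) - c\<^sup>2 * ?f j)"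
    by linarith
  then have split: "\<bar>autocov a (int k) - c\<^sup>2 * power_corr b k\<bar>
      \<le> \<bar>a 0\<bar> * \<bar>a k\<bar> + \<bar>\<Sum>j. a (Suc j) * a (Suc j + k) - c\<^sup>2 * ?f j\<bar>"
    using abs_triangle_ineq[of "a 0 * a k"] by (simp only: abs_mult)
  have "\<bar>\<Sum>j. a (Suc j) * a (Suc j + k) - c\<^sup>2 * ?f j\<bar> \<le> (\<Sum>j. (2 * c + K) * K * ?e j)"
  proof -
    have s: "summable (\<lambda>j. (2 * c + K) * K * ?e j)" by (rule summable_mult[OF se])
    have "norm (a (Suc j) * a (Suc j + k) - c\<^sup>2 * ?f j) \<le> (2 * c + K) * K * ?e j" for j
      unfolding real_norm_def by (rule product_error)
    from norm_suminf_le[OF this s] show ?thesis unfolding real_norm_def .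
  qed
  also have "\<dots> = (2 * c + K) * K * (\<Sum>j. ?e j)"
    by (rule suminf_mult[OF se])
  also have "\<dots> \<le> (2 * c + K) * K * (C * real k powr (- decay))"
  proof (rule mult_left_mono)
    have "(\<Sum>j. ?e j) \<le> C * real k powr (1 - (b + \<delta>) - b)"
      unfolding C_def by (rule power_convolution_le) (use b \<delta> k in auto)
    also have "1 - (b + \<delta>) - b = - decay"
      by (simp add: decay_def)
    finally show "(\<Sum>j. ?e j) \<le> C * real k powr (- decay)" .
  qed (use c K_nonneg in simp)
  finally have tail: "\<bar>\<Sum>j. a (Suc j) * a (Suc j + k) - c\<^sup>2 * ?f j\<bar> \<le> (2 * c + K) * K * (C * real k powr (- decay))" .
  have "\<bar>a k\<bar> \<le> (c + K) * real k powr (- b)"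
    using coeff_le[of "k - 1"] k by simp
  also have "\<dots> \<le> (c + K) * real k powr (- decay)"
    using c K_nonneg k decay by (intro mult_left_mono powr_mono) auto
  finally have "\<bar>a 0\<bar> * \<bar>a k\<bar> \<le> \<bar>a 0\<bar> * ((c + K) * real k powr (- decay))"
    by (rule mult_left_mono) simp
  then have "\<bar>autocov a (int k) - c\<^sup>2 * power_corr b k\<bar>
      \<le> \<bar>a 0\<bar> * ((c + K) * real k powr (- decay)) + (2 * c + K) * K * (C * real k powr (- decay))"
    using split tail by linarith
  then show "\<bar>autocov a (int k) - c\<^sup>2 * power_corr b k\<bar>
      \<le> (\<bar>a 0\<bar> * (c + K) + (2 * c + K) * K * C) * real k powr (- decay)"
    by (simp add: algebra_simps)
qed

lemma autocov_upper:
  obtains K1 where "0 \<le> K1" "\<And>k. 1 \<le> k \<Longrightarrow> \<bar>autocov a (int k)\<bar> \<le> K1 * real k powr (1 - 2 * b)"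
proof -
  obtain K1 where K1: "0 \<le> K1"
    "\<And>k. 1 \<le> k \<Longrightarrow> \<bar>autocov a (int k) - c\<^sup>2 * power_corr b k\<bar> \<le> K1 * real k powr (- decay)"
    by (rule autocov_approx_pos) (rule that)
  define C where "C = 1 / (1 - b) + 1 / (2 * b - 1)"
  have C: "0 \<le> C" using b by (simp add: C_def)
  show ?thesis
  proof
    show "0 \<le> K1 + c\<^sup>2 * C" using K1 C by simp
    fix k :: nat assume k: "1 \<le> k"
    have "c\<^sup>2 * power_corr b k \<le> c\<^sup>2 * (C * real k powr (1 - 2 * b))"
      unfolding C_def by (intro mult_left_mono power_corr_upper b k) auto
    moreover have "0 \<le> c\<^sup>2 * power_corr b k" using power_corr_nonneg[OF b] by simp
    moreover have "K1 * real k powr (- decay) \<le> K1 * real k powr (1 - 2 * b)"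
      using K1 k \<delta> by (intro mult_left_mono powr_mono) (auto simp: decay_def)
    ultimately have "\<bar>autocov a (int k)\<bar> \<le> K1 * real k powr (1 - 2 * b) + c\<^sup>2 * (C * real k powr (1 - 2 * b))"
      using K1(2)[OF k] by linarith
    then show "\<bar>autocov a (int k)\<bar> \<le> (K1 + c\<^sup>2 * C) * real k powr (1 - 2 * b)"
      by (simp add: algebra_simps)
  qed
qed

definition power_block :: "nat \<Rightarrow> real" where
  "power_block l = (\<Sum>s\<in>{1..int l}. \<Sum>t\<in>{1..int l}. power_corr b (nat \<bar>s - t\<bar>))"

lemma autocov_abs: "autocov a (int (nat \<bar>k\<bar>)) = autocov a k"
  by (simp add: autocov_def)

text \<open>
  Lag errors of order \<open>d powr (- decay)\<close> with \<open>decay < 1\<close> add up, over all pairs of times in a block of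
  length \<open>l\<close>, to \<open>l powr (2 - decay)\<close>.
\<close>

lemma block_variance_approx:
  obtains K2 where "0 \<le> K2"
    "\<And>l. \<bar>block_cov a l 0 - c\<^sup>2 * power_block l\<bar> \<le> K2 * real l powr (2 - decay)"
proof -
  obtain K1 where K1: "0 \<le> K1"
    "\<And>k. 1 \<le> k \<Longrightarrow> \<bar>autocov a (int k) - c\<^sup>2 * power_corr b k\<bar> \<le> K1 * real k powr (- decay)"
    by (rule autocov_approx_pos) (rule that)
  define x where "x k = autocov a (int k) - c\<^sup>2 * power_corr b k" for k
  have x: "\<bar>x d\<bar> \<le> (\<bar>x 0\<bar> + 2 * K1) * real (Suc d) powr (- decay)" for d
    by (rule shift_power_bound) (use K1 decay in \<open>auto simp: x_def\<close>)
  have "block_cov a l 0 - c\<^sup>2 * power_block l = (\<Sum>s\<in>{1..int l}. \<Sum>t\<in>{1..int l}. x (nat \<bar>s - t\<bar>))" for l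
    by (simp only: block_cov_def power_block_def x_def autocov_abs sum_distrib_left sum_subtractf add_0)
  then show ?thesis
    using that[of "2 * (\<bar>x 0\<bar> + 2 * K1) / (1 - decay)"] double_sum_powr_bound[OF x] decay K1 by simp
qed

text \<open>
  Writing each of the \<open>2 * l\<close> times as \<open>2 * s\<close> or \<open>2 * s - 1\<close>, the pair \<open>(s, t)\<close> of a block of length \<open>l\<close>
  turns into four pairs with distances \<open>2 * (s - t)\<close> (twice) and \<open>2 * (s - t) \<plusminus> 1\<close>. The distances off
  by one cost \<open>power_corr_step\<close>, and the doubling of the lag costs \<open>power_corr_double\<close>.
\<close>

lemma power_block_double:
  obtains K3 where "0 \<le> K3"
    "\<And>l. \<bar>power_block (2 * l) - 2 powr (3 - 2 * b) * power_block l\<bar> \<le> K3 * real l powr (2 - decay)"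
proof -
  define C where "C = 1 / (1 - b) + 1 / (2 * b - 1)"
  have C: "0 \<le> C" using b by (simp add: C_def)
  define f where "f = power_corr b"
  define x where "x d = 2 * f (2 * d) + f (2 * d + 1) + f (nat \<bar>2 * int d - 1\<bar>) - 2 powr (3 - 2 * b) * f d" for d
  have x: "\<bar>x d\<bar> \<le> (4 + 2 * C) * real d powr (- decay)" if d: "1 \<le> d" for d
  proof -
    define q where "q = real d powr (- decay)"
    have four: "2 powr (3 - 2 * b) = 4 * 2 powr (1 - 2 * b)"
      using powr_add[of 2 2 "1 - 2 * b"] by simp
    \<comment> \<open>The first term left over in the pairing: decay \<le> b, which is \<delta> \<le> 1 - b.\<close>
    have dp: "real d powr (- b) \<le> q"
      unfolding q_def by (rule powr_mono) (use decay d in auto)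
    \<comment> \<open>The loss of one step of the lag: it has order d^(-2b), and decay \<le> 2b.\<close>
    have fd: "f m / real m' \<le> C * q" if "d \<le> m" "d \<le> m'" for m m'
    proof -
      have "f m / real m' \<le> f d / real d"
        unfolding f_def by (intro frac_le power_corr_antimono b power_corr_nonneg) (use that d in auto)
      also have "\<dots> \<le> C * real d powr (1 - 2 * b) / real d"
        unfolding f_def C_def by (intro divide_right_mono power_corr_upper b) (use d in auto)
      also have "\<dots> = C * real d powr (- (2 * b))"
        using d by (simp add: powr_diff powr_minus_divide)
      also have "\<dots> \<le> C * q"
        unfolding q_def by (intro mult_left_mono powr_mono) (use decay d C in auto)
      finally show ?thesis .
    qed
    have 1: "2 powr (1 - 2 * b) * f d \<le> f (2 * d)" "f (2 * d) \<le> 2 powr (1 - 2 * b) * f d + q"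
      using power_corr_double[OF b d] dp by (auto simp: f_def)
    have 2: "f (2 * d + 1) \<le> f (2 * d)" "f (2 * d) - f (2 * d + 1) \<le> C * q"
      using power_corr_step[OF b, of "2 * d"] fd[of "2 * d" "2 * d + 1"] d
      by (auto simp: f_def intro!: power_corr_antimono[OF b])
    have e: "nat \<bar>2 * int d - 1\<bar> = 2 * d - 1" using d by auto
    have e2: "Suc (2 * d - 1) = 2 * d" using d by auto
    have le: "d \<le> 2 * d - 1" "d \<le> 2 * d" using d by auto
    have 3: "f (2 * d) \<le> f (2 * d - 1)" "f (2 * d - 1) - f (2 * d) \<le> C * q"
      using power_corr_step[OF b, of "2 * d - 1"] fd[OF le]
      unfolding e2 by (auto simp: f_def intro!: power_corr_antimono[OF b])
    have "\<bar>x d\<bar> \<le> 4 * q + 2 * (C * q)"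
      unfolding x_def e four using 1 2 3 by linarith
    then show ?thesis unfolding q_def by (simp add: algebra_simps)
  qed
  have x': "\<bar>x d\<bar> \<le> (\<bar>x 0\<bar> + 2 * (4 + 2 * C)) * real (Suc d) powr (- decay)" for d
    by (rule shift_power_bound) (use x decay C in auto)
  have x_abs: "x (nat \<bar>z\<bar>) = 2 * f (nat \<bar>2 * z\<bar>) + f (nat \<bar>2 * z + 1\<bar>) + f (nat \<bar>2 * z - 1\<bar>)
      - 2 powr (3 - 2 * b) * f (nat \<bar>z\<bar>)" for z
  proof (cases "z \<ge> 0")
    case True
    then have e: "2 * nat \<bar>z\<bar> = nat \<bar>2 * z\<bar>" "nat \<bar>2 * z\<bar> + 1 = nat \<bar>2 * z + 1\<bar>"
      "nat \<bar>2 * int (nat \<bar>z\<bar>) - 1\<bar> = nat \<bar>2 * z - 1\<bar>" by auto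
    then show ?thesis unfolding x_def e by linarith
  next
    case False
    then have e: "2 * nat \<bar>z\<bar> = nat \<bar>2 * z\<bar>" "nat \<bar>2 * z\<bar> + 1 = nat \<bar>2 * z - 1\<bar>"
      "nat \<bar>2 * int (nat \<bar>z\<bar>) - 1\<bar> = nat \<bar>2 * z + 1\<bar>" by auto
    then show ?thesis unfolding x_def e by linarith
  qed
  have "power_block (2 * l) - 2 powr (3 - 2 * b) * power_block l =
      (\<Sum>s\<in>{1..int l}. \<Sum>t\<in>{1..int l}. x (nat \<bar>s - t\<bar>))" for l
  proof -
    have "power_block (2 * l) = (\<Sum>s\<in>{1..int l}. \<Sum>t\<in>{1..int l}.
        2 * f (nat \<bar>2 * (s - t)\<bar>) + f (nat \<bar>2 * (s - t) + 1\<bar>) + f (nat \<bar>2 * (s - t) - 1\<bar>))"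
      unfolding power_block_def f_def[symmetric] sum_split_parity sum.distrib[symmetric]
      by (intro sum.cong refl) (simp add: algebra_simps)
    then show ?thesis
      unfolding x_abs by (simp add: power_block_def f_def sum_subtractf sum_distrib_left)
  qed
  then show ?thesis
    using that[of "2 * (\<bar>x 0\<bar> + 2 * (4 + 2 * C)) / (1 - decay)"] double_sum_powr_bound[OF x'] decay C by simp
qed

text \<open>
  The autocovariance decreases, so each of the \<open>l\<^sup>2\<close> terms is at least its value at lag \<open>l\<close>.
\<close>

lemma power_block_lower: "2 powr (- b) * real l powr (3 - 2 * b) \<le> power_block l"
proof (cases "l = 0")
  case False
  have "2 powr (- b) * real l powr (3 - 2 * b) = real l * (real l * (2 powr (- b) * real l powr (1 - 2 * b)))"
    by (simp add: powr_mult_base mult.left_commute)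
  also have "\<dots> = (\<Sum>s\<in>{1..int l}. \<Sum>t\<in>{1..int l}. 2 powr (- b) * real l powr (1 - 2 * b))"
    by simp
  also have "\<dots> \<le> (\<Sum>s\<in>{1..int l}. \<Sum>t\<in>{1..int l}. power_corr b l)"
    by (intro sum_mono power_corr_lower b) (use False in auto)
  also have "\<dots> \<le> power_block l"
    unfolding power_block_def by (intro sum_mono power_corr_antimono b) auto
  finally show ?thesis .
qed (simp add: power_block_def)

lemma block_variance_double:
  obtains K4 where "0 \<le> K4"
    "\<And>l. \<bar>block_cov a (2 * l) 0 - 2 powr (3 - 2 * b) * block_cov a l 0\<bar> \<le> K4 * real l powr (3 - 2 * b - \<delta>)"
proof -
  obtain K2 where K2: "0 \<le> K2" "\<And>l. \<bar>block_cov a l 0 - c\<^sup>2 * power_block l\<bar> \<le> K2 * real l powr (2 - decay)"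
    by (rule block_variance_approx) (rule that)
  obtain K3 where K3: "0 \<le> K3"
    "\<And>l. \<bar>power_block (2 * l) - 2 powr (3 - 2 * b) * power_block l\<bar> \<le> K3 * real l powr (2 - decay)"
    by (rule power_block_double) (rule that)
  define D :: real where "D = 2 powr (3 - 2 * b)"
  have D: "D > 0" by (simp add: D_def)
  show ?thesis
  proof
    show "0 \<le> K2 * 2 powr (2 - decay) + c\<^sup>2 * K3 + D * K2" using K2 K3 D by simp
    fix l
    define q where "q = real l powr (2 - decay)"
    have "\<bar>block_cov a (2 * l) 0 - c\<^sup>2 * power_block (2 * l)\<bar> \<le> K2 * (2 powr (2 - decay) * q)"
      using K2(2)[of "2 * l"] by (simp add: powr_mult q_def)
    moreover have "\<bar>c\<^sup>2 * (power_block (2 * l) - D * power_block l)\<bar> \<le> c\<^sup>2 * (K3 * q)"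
      unfolding abs_mult D_def q_def using K3(2)[of l] by (simp add: mult_left_mono)
    moreover have "\<bar>D * (block_cov a l 0 - c\<^sup>2 * power_block l)\<bar> \<le> D * (K2 * q)"
      unfolding abs_mult q_def using K2(2)[of l] D by (simp add: mult_left_mono)
    moreover have "block_cov a (2 * l) 0 - D * block_cov a l 0 =
        (block_cov a (2 * l) 0 - c\<^sup>2 * power_block (2 * l)) + c\<^sup>2 * (power_block (2 * l) - D * power_block l)
        - D * (block_cov a l 0 - c\<^sup>2 * power_block l)"
      by (simp add: algebra_simps)
    ultimately have "\<bar>block_cov a (2 * l) 0 - D * block_cov a l 0\<bar>
        \<le> K2 * (2 powr (2 - decay) * q) + c\<^sup>2 * (K3 * q) + D * (K2 * q)"
      by linarith
    also have "\<dots> = (K2 * 2 powr (2 - decay) + c\<^sup>2 * K3 + D * K2) * q"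
      by (simp add: algebra_simps)
    also have "q = real l powr (3 - 2 * b - \<delta>)"
      unfolding q_def decay_def by (rule arg_cong[of _ _ "\<lambda>z. real l powr z"]) simp
    finally show "\<bar>block_cov a (2 * l) 0 - 2 powr (3 - 2 * b) * block_cov a l 0\<bar>
        \<le> (K2 * 2 powr (2 - decay) + c\<^sup>2 * K3 + D * K2) * real l powr (3 - 2 * b - \<delta>)"
      unfolding D_def .
  qed
qed

lemma block_variance_lower:
  obtains \<kappa> where "0 < \<kappa>" "\<forall>\<^sub>F l in sequentially. \<kappa> * real l powr (3 - 2 * b) \<le> block_cov a l 0"
proof -
  obtain K2 where K2: "0 \<le> K2" "\<And>l. \<bar>block_cov a l 0 - c\<^sup>2 * power_block l\<bar> \<le> K2 * real l powr (2 - decay)"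
    by (rule block_variance_approx) (rule that)
  define \<kappa> where "\<kappa> = c\<^sup>2 * 2 powr (- b) / 2"
  have \<kappa>: "0 < \<kappa>" using c by (simp add: \<kappa>_def)
  have "(\<lambda>l. K2 * real l powr (- \<delta>)) \<longlonglongrightarrow> K2 * 0"
    by (intro tendsto_mult tendsto_const tendsto_neg_powr filterlim_real_sequentially) (use \<delta> in auto)
  then have "\<forall>\<^sub>F l in sequentially. K2 * real l powr (- \<delta>) < \<kappa>"
    using \<kappa> by (intro order_tendstoD(2)) auto
  then have "\<forall>\<^sub>F l in sequentially. \<kappa> * real l powr (3 - 2 * b) \<le> block_cov a l 0"
  proof eventually_elim
    case (elim l)
    have "real l powr (2 - decay) = real l powr (3 - 2 * b + - \<delta>)"
      unfolding decay_def by (rule arg_cong[of _ _ "\<lambda>z. real l powr z"]) simp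
    also have "\<dots> = real l powr (- \<delta>) * real l powr (3 - 2 * b)"
      by (simp only: powr_add mult.commute)
    finally have "K2 * real l powr (2 - decay) \<le> \<kappa> * real l powr (3 - 2 * b)"
      using elim by (simp add: mult_right_mono flip: mult.assoc)
    moreover have "2 * \<kappa> * real l powr (3 - 2 * b) \<le> c\<^sup>2 * power_block l"
      using mult_left_mono[OF power_block_lower[of l], of "c\<^sup>2"] by (simp add: \<kappa>_def mult.assoc)
    ultimately show ?case using K2(2)[of l] by linarith
  qed
  then show ?thesis using that \<kappa> by blast
qed

end

section \<open>Relative variance of the block statistic\<close>

lemma sum_inverse_tail_le:
  assumes "1 \<le> k" "k \<le> n"
  shows "(\<Sum>j\<in>{k..<n}. real (Suc j) powr (- 1)) \<le> ln (real n / real k)"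
  using assms(2)
proof (induction n rule: dec_induct)
  case (step n)
  have n: "real n > 0" using step assms by simp
  have "1 - inverse (real (Suc n) / real n) \<le> ln (real (Suc n) / real n)"
    using ln_le_minus_one[of "real n / real (Suc n)"] n by (simp add: ln_div)
  then have "real (Suc n) powr (- 1) \<le> ln (real (Suc n) / real n)"
    using n by (simp add: powr_minus_divide field_simps)
  also have "\<dots> = ln (real (Suc n) / real k) - ln (real n / real k)"
    using n assms by (simp add: ln_div)
  finally show ?case using step by simp
qed (use assms in auto)

text \<open>
  The three cases of \<open>vrate\<close> correspond to the behaviour of the sum of \<open>j powr (- q)\<close> over \<open>h < j \<le> n\<close>,
  where \<open>q = 4 * b - 2\<close>: for \<open>q < 1\<close> it is governed by its upper end, for \<open>q = 1\<close> it is logarithmic, and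
  for \<open>q > 1\<close> it is governed by its lower end.
\<close>

lemma vrate_square_dominates:
  assumes b: "1 / 2 < b" "b < 1"
  obtains C where "0 \<le> C" "\<And>h n. 1 \<le> h \<Longrightarrow> h \<le> n \<Longrightarrow>
      (real h + real h powr (4 * b - 2) * (\<Sum>j\<in>{h..<n}. real (Suc j) powr (- (4 * b - 2)))) / real n
        \<le> C * (vrate b n h)\<^sup>2"
proof -
  define q where "q = 4 * b - 2"
  have q: "0 < q" "q < 2" using b by (auto simp: q_def)
  consider "q < 1" | "q = 1" | "q > 1" by linarith
  then obtain C where C: "0 \<le> C" and bound: "\<And>h n. 1 \<le> h \<Longrightarrow> h \<le> n \<Longrightarrow>
      (real h + real h powr q * (\<Sum>j\<in>{h..<n}. real (Suc j) powr (- q))) / real n \<le> C * (vrate b n h)\<^sup>2"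
  proof cases
    case 1
    show ?thesis
    proof (rule that)
      show "0 \<le> 1 + 1 / (1 - q)" using 1 by simp
      fix h n :: nat assume hn: "1 \<le> h" "h \<le> n"
      define r where "r = real h / real n"
      have r: "0 < r" "r \<le> 1" using hn by (auto simp: r_def)
      have v: "(vrate b n h)\<^sup>2 = r powr q"
        using 1 by (simp add: vrate_def r_def[symmetric] q_def power2_eq_square powr_add[symmetric])
      have "(\<Sum>j\<in>{h..<n}. real (Suc j) powr (- q)) \<le> (\<Sum>j<n. real (Suc j) powr (- q))"
        by (rule sum_mono2) auto
      also have "\<dots> \<le> real n powr (1 - q) / (1 - q)"
        by (rule sum_powr_le) (use q 1 in auto)
      finally have "real h powr q * (\<Sum>j\<in>{h..<n}. real (Suc j) powr (- q)) / real n
          \<le> real h powr q * (real n powr (1 - q) / (1 - q)) / real n"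
        by (intro divide_right_mono mult_left_mono) auto
      also have "\<dots> = r powr q / (1 - q)"
        using hn by (simp add: r_def powr_divide powr_diff)
      finally have "real h powr q * (\<Sum>j\<in>{h..<n}. real (Suc j) powr (- q)) / real n \<le> r powr q / (1 - q)" .
      moreover have "r powr 1 \<le> r powr q"
        by (rule powr_mono') (use r 1 in auto)
      ultimately show "(real h + real h powr q * (\<Sum>j\<in>{h..<n}. real (Suc j) powr (- q))) / real n
          \<le> (1 + 1 / (1 - q)) * (vrate b n h)\<^sup>2"
        unfolding v using r by (simp add: add_divide_distrib algebra_simps r_def[symmetric])
    qed
  next
    case 2
    show ?thesis
    proof (rule that)
      show "0 \<le> (1::real)" by simp
      fix h n :: nat assume hn: "1 \<le> h" "h \<le> n"
      have b': "b = 3 / 4" using 2 by (simp add: q_def)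
      have "ln (real n / real h) \<ge> 0" using hn by simp
      then have v: "(vrate b n h)\<^sup>2 = real h / real n * (1 + ln (real n / real h))"
        by (simp add: vrate_def b')
      have "(real h + real h powr q * (\<Sum>j\<in>{h..<n}. real (Suc j) powr (- q))) / real n
          \<le> (real h + real h * ln (real n / real h)) / real n"
        unfolding 2 using sum_inverse_tail_le[OF hn] by (intro divide_right_mono add_mono mult_mono) (auto intro: sum_nonneg)
      then show "(real h + real h powr q * (\<Sum>j\<in>{h..<n}. real (Suc j) powr (- q))) / real n
          \<le> 1 * (vrate b n h)\<^sup>2"
        unfolding v by (simp add: algebra_simps add_divide_distrib)
    qed
  next
    case 3
    show ?thesis
    proof (rule that)
      show "0 \<le> 1 + 1 / (q - 1)" using 3 by simp
      fix h n :: nat assume hn: "1 \<le> h" "h \<le> n"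
      have v: "(vrate b n h)\<^sup>2 = real h / real n"
        using 3 by (simp add: vrate_def q_def)
      have "(\<Sum>j\<in>{h..<n}. real (Suc j) powr (- q)) \<le> (real h powr (1 - q) - real n powr (1 - q)) / (q - 1)"
        by (rule sum_powr_tail_le) (use 3 hn in auto)
      also have "\<dots> \<le> real h powr (1 - q) / (q - 1)"
        using 3 by (simp add: divide_right_mono)
      finally have "real h powr q * (\<Sum>j\<in>{h..<n}. real (Suc j) powr (- q))
          \<le> real h powr q * (real h powr (1 - q) / (q - 1))"
        by (rule mult_left_mono) simp
      also have "\<dots> = real h / (q - 1)"
        using hn by (simp add: powr_add[symmetric])
      finally have "(real h + real h powr q * (\<Sum>j\<in>{h..<n}. real (Suc j) powr (- q))) / real n
          \<le> (real h + real h / (q - 1)) / real n"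
        by (intro divide_right_mono) auto
      then show "(real h + real h powr q * (\<Sum>j\<in>{h..<n}. real (Suc j) powr (- q))) / real n
          \<le> (1 + 1 / (q - 1)) * (vrate b n h)\<^sup>2"
        unfolding v by (simp add: algebra_simps add_divide_distrib)
    qed
  qed
  show ?thesis by (rule that[OF C bound[unfolded q_def]])
qed

lemma block_cov_even: "block_cov a l (- d) = block_cov a l d"
proof -
  have "autocov a (- d + s - t) = autocov a (d + t - s)" for s t
  proof -
    have "nat \<bar>- d + s - t\<bar> = nat \<bar>d + t - s\<bar>" by linarith
    then show ?thesis by (simp only: autocov_def)
  qed
  then show ?thesis
    unfolding block_cov_def by (subst sum.swap) simp
qed

context power_law_coefficients
begin

text \<open>
  If the blocks are at least one block length apart, all \<open>l\<^sup>2\<close> lags between them are at least \<open>d / 2\<close>.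
\<close>

lemma block_cov_far:
  obtains K5 where "0 \<le> K5"
    "\<And>l d. 1 \<le> l \<Longrightarrow> 2 * l \<le> d \<Longrightarrow> \<bar>block_cov a l (int d)\<bar> \<le> K5 * (real l)\<^sup>2 * real d powr (1 - 2 * b)"
proof -
  obtain K1 where K1: "0 \<le> K1" "\<And>k. 1 \<le> k \<Longrightarrow> \<bar>autocov a (int k)\<bar> \<le> K1 * real k powr (1 - 2 * b)"
    by (rule autocov_upper) (rule that)
  show ?thesis
  proof (rule that)
    show "0 \<le> 2 * K1" using K1 by simp
    fix l d :: nat assume l: "1 \<le> l" "2 * l \<le> d"
    have each: "\<bar>autocov a (int d + s - t)\<bar> \<le> 2 * K1 * real d powr (1 - 2 * b)"
      if "s \<in> {1..int l}" "t \<in> {1..int l}" for s t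
    proof -
      define k where "k = nat (int d + s - t)"
      have k: "int d + s - t = int k" "1 \<le> k" "real d \<le> 2 * real k"
        using that l by (auto simp: k_def)
      have "real k powr (1 - 2 * b) = 2 powr (2 * b - 1) * (2 * real k) powr (1 - 2 * b)"
        by (simp add: powr_mult powr_diff)
      also have "\<dots> \<le> 2 powr 1 * real d powr (1 - 2 * b)"
        by (intro mult_mono powr_mono powr_mono2') (use b k l in auto)
      finally have "K1 * real k powr (1 - 2 * b) \<le> K1 * (2 * real d powr (1 - 2 * b))"
        using K1 by (intro mult_left_mono) auto
      then show ?thesis using K1(2)[OF k(2)] unfolding k(1) by simp
    qed
    have "\<bar>block_cov a l (int d)\<bar> \<le> (\<Sum>s\<in>{1..int l}. \<Sum>t\<in>{1..int l}. 2 * K1 * real d powr (1 - 2 * b))"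
      unfolding block_cov_def by (intro order_trans[OF sum_abs] sum_mono each)
    then show "\<bar>block_cov a l (int d)\<bar> \<le> 2 * K1 * (real l)\<^sup>2 * real d powr (1 - 2 * b)"
      by (simp add: power2_eq_square mult_ac)
  qed
qed

text \<open>
  The block variance serves as the unit for both ranges of distances: pairs of blocks closer than
  \<open>2 * l\<close> contribute at most its square by \<open>block_cov_le_variance\<close>, and for distant pairs its
  lower bound \<open>\<kappa> * l powr (3 - 2 * b)\<close> turns \<open>block_cov_far\<close> into a relative bound. Only \<open>l = h\<close> and
  \<open>l = 2 * h\<close> occur, so everything can be expressed by \<open>h\<close>.
\<close>

lemma block_variance_bound:
  obtains C where "0 \<le> C"
    "\<forall>\<^sub>F h in sequentially. \<forall>n l. 4 * h \<le> n \<longrightarrow> l \<in> {h, 2 * h} \<longrightarrow> 0 < block_cov a l 0 \<and>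
      2 / (real n - real l + 1)\<^sup>2 *
        (\<Sum>i\<in>{0..int n - int l}. \<Sum>j\<in>{0..int n - int l}. (block_cov a l (i - j))\<^sup>2)
      \<le> C * (vrate b n h)\<^sup>2 * (block_cov a l 0)\<^sup>2"
proof -
  obtain K5 where K5: "0 \<le> K5"
    "\<And>l d. 1 \<le> l \<Longrightarrow> 2 * l \<le> d \<Longrightarrow> \<bar>block_cov a l (int d)\<bar> \<le> K5 * (real l)\<^sup>2 * real d powr (1 - 2 * b)"
    by (rule block_cov_far) (rule that)
  obtain \<kappa> where \<kappa>: "0 < \<kappa>" "\<forall>\<^sub>F l in sequentially. \<kappa> * real l powr (3 - 2 * b) \<le> block_cov a l 0"
    by (rule block_variance_lower) (rule that)
  obtain D where D: "0 \<le> D" "\<And>h n. 1 \<le> h \<Longrightarrow> h \<le> n \<Longrightarrow>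
      (real h + real h powr (4 * b - 2) * (\<Sum>j\<in>{h..<n}. real (Suc j) powr (- (4 * b - 2)))) / real n
        \<le> D * (vrate b n h)\<^sup>2"
    by (rule vrate_square_dominates[OF b]) (rule that)
  obtain h0 where h0: "\<And>l. h0 \<le> l \<Longrightarrow> \<kappa> * real l powr (3 - 2 * b) \<le> block_cov a l 0"
    using \<kappa>(2) unfolding eventually_sequentially by metis
  define q where "q = 4 * b - 2"
  have q: "0 < q" "q < 2" using b by (auto simp: q_def)
  define E where "E = (K5 / \<kappa>)\<^sup>2"
  have E: "0 \<le> E" by (simp add: E_def)
  show ?thesis
  proof (rule that)
    show "0 \<le> 32 * (1 + E) * D" using D E by simp
    show "\<forall>\<^sub>F h in sequentially. \<forall>n l. 4 * h \<le> n \<longrightarrow> l \<in> {h, 2 * h} \<longrightarrow> 0 < block_cov a l 0 \<and>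
      2 / (real n - real l + 1)\<^sup>2 *
        (\<Sum>i\<in>{0..int n - int l}. \<Sum>j\<in>{0..int n - int l}. (block_cov a l (i - j))\<^sup>2)
      \<le> 32 * (1 + E) * D * (vrate b n h)\<^sup>2 * (block_cov a l 0)\<^sup>2"
      using eventually_ge_at_top[of "max 1 h0"]
    proof (eventually_elim, intro allI impI)
      fix h n l :: nat
      assume h: "max 1 h0 \<le> h" and n: "4 * h \<le> n" and l: "l \<in> {h, 2 * h}"
      define V where "V = block_cov a l 0"
      define N where "N = card {0..int n - int l}"
      define g where "g d = (block_cov a l (int d))\<^sup>2" for d
      have hl: "1 \<le> h" "h \<le> l" "l \<le> 2 * h" "1 \<le> l" "h0 \<le> l" "h \<le> n" using h l n by auto
      have N: "real N = real n - real l + 1" "real n / 2 \<le> real N" "N \<le> n" "0 < N"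
        using hl n by (auto simp: N_def)
      have "0 < \<kappa> * real l powr (3 - 2 * b)" using \<kappa> hl by simp
      then have Vpos: "0 < V" and V: "\<kappa> * real l powr (3 - 2 * b) \<le> V"
        using h0[OF hl(5)] by (auto simp: V_def)
      have g0: "0 \<le> g d" for d by (simp add: g_def)
      have near: "g d \<le> V\<^sup>2" for d
        unfolding g_def V_def by (rule block_cov_le_variance[OF coeff_square_summable]) simp
      have far: "g d \<le> V\<^sup>2 * (E * real l powr q * real d powr (- q))" if "2 * l \<le> d" for d
      proof -
        have lp: "(real l)\<^sup>2 = real l powr (3 - 2 * b) * real l powr (2 * b - 1)"
          using hl by (simp add: powr_add[symmetric])
        have "\<bar>block_cov a l (int d)\<bar> \<le> K5 * (real l)\<^sup>2 * real d powr (1 - 2 * b)"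
          by (rule K5) (use hl that in auto)
        also have "\<dots> = K5 / \<kappa> * (\<kappa> * real l powr (3 - 2 * b)) * (real l powr (2 * b - 1) * real d powr (1 - 2 * b))"
          using \<kappa> by (simp add: lp)
        also have "\<dots> \<le> K5 / \<kappa> * V * (real l powr (2 * b - 1) * real d powr (1 - 2 * b))"
          using K5 \<kappa> V by (intro mult_right_mono mult_left_mono) auto
        finally have "\<bar>block_cov a l (int d)\<bar>\<^sup>2 \<le> (K5 / \<kappa> * V * (real l powr (2 * b - 1) * real d powr (1 - 2 * b)))\<^sup>2"
          by (rule power_mono) simp
        also have "\<dots> = V\<^sup>2 * (E * ((real l powr (2 * b - 1))\<^sup>2 * (real d powr (1 - 2 * b))\<^sup>2))"
          by (simp add: E_def power_mult_distrib power_divide)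
        also have "(real l powr (2 * b - 1))\<^sup>2 = real l powr q"
          by (simp add: power2_eq_square powr_add[symmetric] q_def)
        also have "(real d powr (1 - 2 * b))\<^sup>2 = real d powr (- q)"
          by (simp add: power2_eq_square powr_add[symmetric] q_def)
        finally show ?thesis by (simp add: g_def mult_ac)
      qed
      \<comment> \<open>The constant 4 is 2^2: here l \<le> 2h and q < 2.\<close>
      have lq: "real l powr q \<le> 4 * real h powr q"
      proof -
        have "real l powr q \<le> (2 * real h) powr q"
          by (rule powr_mono2) (use hl q in auto)
        also have "\<dots> \<le> 2 powr 2 * real h powr q"
          unfolding powr_mult by (intro mult_right_mono powr_mono) (use q in auto)
        finally show ?thesis by simp
      qed
      define T where "T = (\<Sum>j\<in>{h..<n}. real (Suc j) powr (- q))"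
      have T: "0 \<le> T" by (simp add: T_def sum_nonneg)
      have "(\<Sum>d\<in>{2 * l..<n}. real d powr (- q)) \<le> (\<Sum>d\<in>Suc ` {h..<n}. real d powr (- q))"
      proof (rule sum_mono2)
        show "{2 * l..<n} \<subseteq> Suc ` {h..<n}"
          using hl by (auto simp: image_Suc_atLeastLessThan)
      qed auto
      then have tail: "(\<Sum>d\<in>{2 * l..<n}. real d powr (- q)) \<le> T"
        unfolding T_def by (simp add: sum.reindex del: image_Suc_atLeastLessThan)
      have "(\<Sum>d<N. g d) \<le> (\<Sum>d<n. g d)"
        by (rule sum_mono2) (use N g0 in auto)
      also have "\<dots> \<le> (\<Sum>d\<in>{..<2 * l} \<union> {2 * l..<n}. g d)"
        by (rule sum_mono2) (use g0 in auto)
      also have "\<dots> = (\<Sum>d<2 * l. g d) + (\<Sum>d\<in>{2 * l..<n}. g d)"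
        by (rule sum.union_disjoint) auto
      also have "\<dots> \<le> (\<Sum>d<2 * l. V\<^sup>2) + (\<Sum>d\<in>{2 * l..<n}. V\<^sup>2 * (E * real l powr q * real d powr (- q)))"
        by (intro add_mono sum_mono near far) auto
      also have "\<dots> = V\<^sup>2 * (2 * real l + E * (real l powr q * (\<Sum>d\<in>{2 * l..<n}. real d powr (- q))))"
        by (simp add: sum_distrib_left algebra_simps)
      also have "\<dots> \<le> V\<^sup>2 * (2 * (2 * real h) + E * (4 * real h powr q * T))"
        by (intro mult_left_mono add_mono mult_mono lq tail) (use hl E in \<open>auto intro: sum_nonneg\<close>)
      also have "\<dots> \<le> V\<^sup>2 * (4 * (1 + E) * (real h + real h powr q * T))"
        using E T by (intro mult_left_mono) (auto simp: algebra_simps)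
      finally have sum_g: "(\<Sum>d<N. g d) \<le> V\<^sup>2 * (4 * (1 + E) * (real h + real h powr q * T))" .
      have "block_cov a l (i - j) = block_cov a l \<bar>i - j\<bar>" for i j
        by (cases "i \<ge> j") (simp_all add: block_cov_even[of a l "i - j", symmetric] del: minus_diff_eq)
      then have "(\<Sum>i\<in>{0..int n - int l}. \<Sum>j\<in>{0..int n - int l}. (block_cov a l (i - j))\<^sup>2) =
          (\<Sum>i\<in>{0..int n - int l}. \<Sum>j\<in>{0..int n - int l}. g (nat \<bar>i - j\<bar>))"
        by (simp add: g_def)
      also have "\<dots> \<le> 2 * real N * (\<Sum>d<N. g d)"
        unfolding N_def by (rule sum_abs_diff_le) (rule g0)
      finally have "2 / (real N)\<^sup>2 *
          (\<Sum>i\<in>{0..int n - int l}. \<Sum>j\<in>{0..int n - int l}. (block_cov a l (i - j))\<^sup>2)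
          \<le> 2 / (real N)\<^sup>2 * (2 * real N * (\<Sum>d<N. g d))"
        by (rule mult_left_mono) simp
      also have "\<dots> = 4 / real N * (\<Sum>d<N. g d)"
        using N(4) by (simp add: power2_eq_square)
      also have "\<dots> \<le> 8 / real n * (\<Sum>d<N. g d)"
      proof (rule mult_right_mono)
        show "4 / real N \<le> 8 / real n" using N hl by (simp add: field_simps)
      qed (simp add: sum_nonneg g0)
      also have "\<dots> \<le> 8 / real n * (V\<^sup>2 * (4 * (1 + E) * (real h + real h powr q * T)))"
        by (intro mult_left_mono sum_g) simp
      also have "\<dots> = 32 * (1 + E) * V\<^sup>2 * ((real h + real h powr q * T) / real n)"
        by simp
      also have "\<dots> \<le> 32 * (1 + E) * V\<^sup>2 * (D * (vrate b n h)\<^sup>2)"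
        using E D(2)[of h n] hl unfolding T_def q_def by (intro mult_left_mono) auto
      finally show "0 < block_cov a l 0 \<and> 2 / (real n - real l + 1)\<^sup>2 *
          (\<Sum>i\<in>{0..int n - int l}. \<Sum>j\<in>{0..int n - int l}. (block_cov a l (i - j))\<^sup>2)
          \<le> 32 * (1 + E) * D * (vrate b n h)\<^sup>2 * (block_cov a l 0)\<^sup>2"
        using Vpos unfolding N(1) V_def by (simp add: mult_ac)
    qed
  qed
qed

end

section \<open>Dependence of the normalisation on the exponent\<close>

lemma integral_powr_interval:
  fixes N u :: real
  assumes "1 \<le> N"
  shows "integral {1..N} (\<lambda>x. x powr (2 - 4 * u)) =
    (if u = 3 / 4 then ln N else (N powr (3 - 4 * u) - 1) / (3 - 4 * u))"
proof (cases "u = 3 / 4")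
  case True
  then have e: "2 - 4 * u = - 1" by simp
  have "((\<lambda>x. x powr (2 - 4 * u)) has_integral (ln N - ln 1)) {1..N}"
  proof (rule fundamental_theorem_of_calculus)
    show "(ln has_vector_derivative x powr (2 - 4 * u)) (at x within {1..N})" if "x \<in> {1..N}" for x
      unfolding e using that
      by (auto intro!: derivative_eq_intros simp: powr_minus_divide has_real_derivative_iff_has_vector_derivative[symmetric])
  qed (use assms in auto)
  from integral_unique[OF this] show ?thesis
    unfolding if_P[OF True] by (simp only: ln_one diff_zero)
next
  case False
  define q where "q = 3 - 4 * u"
  have q: "q \<noteq> 0" "2 - 4 * u = q - 1" using False by (auto simp: q_def)
  have "((\<lambda>x. x powr (2 - 4 * u)) has_integral (N powr q / q - 1 powr q / q)) {1..N}"
  proof (rule fundamental_theorem_of_calculus)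
    show "((\<lambda>x. x powr q / q) has_vector_derivative x powr (2 - 4 * u)) (at x within {1..N})"
      if "x \<in> {1..N}" for x
      using that q
      by (auto intro!: derivative_eq_intros simp: has_real_derivative_iff_has_vector_derivative[symmetric])
  qed (use assms in auto)
  then show ?thesis using False by (simp add: integral_unique q_def diff_divide_distrib)
qed

lemma powr_interval_integrable: "(\<lambda>x. x powr q) integrable_on {1..N::real}"
  by (rule integrable_continuous_interval) (auto intro!: continuous_intros)

lemma integral_powr_nonneg: "0 \<le> integral {1..N} (\<lambda>x::real. x powr q)"
  by (rule integral_nonneg[OF powr_interval_integrable]) simp

lemma R_pos: "1 \<le> N \<Longrightarrow> 0 < R N u"
  using integral_powr_nonneg[of "real N" "2 - 4 * u"] by (simp add: R_def add_pos_nonneg)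

text \<open>
  Used for measurability: a monotone function is a Borel function.
\<close>

lemma R_antimono:
  assumes "u \<le> v"
  shows "R N v \<le> R N u"
  unfolding R_def
  by (intro real_sqrt_le_mono divide_right_mono add_left_mono integral_le powr_interval_integrable powr_mono)
    (use assms in auto)

lemma R_measurable [measurable]: "R N \<in> borel_measurable borel"
proof -
  have "mono (\<lambda>u. - R N u)" by (intro monoI) (simp add: R_antimono)
  then have "(\<lambda>u. - (- R N u)) \<in> borel_measurable borel"
    by (intro borel_measurable_uminus borel_measurable_mono)
  then show ?thesis by simp
qed

text \<open>
  On \<open>[1, N]\<close> a change of the exponent by \<open>4 * \<bar>u - v\<bar>\<close> changes a power by a factor of at most
  \<open>N powr (4 * \<bar>u - v\<bar>)\<close>; the square root halves the exponent.
\<close>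

lemma R_perturbation:
  assumes N: "1 \<le> N"
  shows "R N u \<le> real N powr (2 * \<bar>u - v\<bar>) * R N v"
proof -
  let ?d = "\<bar>u - v\<bar>"
  have d: "v - u \<le> ?d" by (simp add: abs_if)
  let ?I = "\<lambda>w. integral {1..real N} (\<lambda>x. x powr (2 - 4 * w))"
  have "?I u \<le> integral {1..real N} (\<lambda>x. real N powr (4 * ?d) * x powr (2 - 4 * v))"
  proof (rule integral_le)
    fix x assume x: "x \<in> {1..real N}"
    have "x powr (2 - 4 * u) \<le> x powr (4 * ?d + (2 - 4 * v))"
    proof (rule powr_mono)
      show "2 - 4 * u \<le> 4 * ?d + (2 - 4 * v)"
        using d by simp
    qed (use x in auto)
    also have "\<dots> = x powr (4 * ?d) * x powr (2 - 4 * v)"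
      by (rule powr_add)
    also have "\<dots> \<le> real N powr (4 * ?d) * x powr (2 - 4 * v)"
      by (intro mult_right_mono powr_mono2) (use x in auto)
    finally show "x powr (2 - 4 * u) \<le> real N powr (4 * ?d) * x powr (2 - 4 * v)" .
  qed (rule integrable_continuous_interval; auto intro!: continuous_intros)+
  also have "\<dots> = real N powr (4 * ?d) * ?I v" by simp
  finally have "1 + ?I u \<le> real N powr (4 * ?d) * (1 + ?I v)"
    using ge_one_powr_ge_zero[of "real N" "4 * ?d"] N by (simp add: distrib_left)
  then have "R N u \<le> sqrt (real N powr (4 * ?d) * ((1 + ?I v) / real N))"
    unfolding R_def using N by (simp add: divide_right_mono)
  also have "\<dots> = sqrt (real N powr (4 * ?d)) * R N v"
    by (simp only: R_def real_sqrt_mult)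
  also have "sqrt (real N powr (4 * ?d)) = real N powr (2 * ?d)"
    using N by (simp add: powr_half_sqrt[symmetric] powr_powr)
  finally show ?thesis .
qed

lemma R_rate_limit:
  assumes "1 / 2 < u" "u < 1"
  shows "\<exists>L>0. (\<lambda>N. R N u / rate u N) \<longlonglongrightarrow> L"
proof -
  have R_eq: "\<forall>\<^sub>F N in sequentially. R N u = sqrt ((1 + (if u = 3 / 4 then ln (real N)
      else (real N powr (3 - 4 * u) - 1) / (3 - 4 * u))) / real N)"
    using eventually_ge_at_top[of 1] by eventually_elim (simp add: R_def integral_powr_interval)
  consider "u > 3 / 4" | "u = 3 / 4" | "u < 3 / 4" by linarith
  then show ?thesis
  proof cases
    case 1
    define q where "q = 3 - 4 * u"
    have q: "q < 0" using 1 by (simp add: q_def)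
    have "(\<lambda>N. sqrt (1 + (real N powr q - 1) / q)) \<longlonglongrightarrow> sqrt (1 + (0 - 1) / q)"
      by (intro tendsto_intros tendsto_neg_powr filterlim_real_sequentially) (use q in auto)
    then have "(\<lambda>N. sqrt (1 + (real N powr q - 1) / q)) \<longlonglongrightarrow> sqrt (1 - 1 / q)"
      by simp
    moreover have "\<forall>\<^sub>F N in sequentially. R N u / rate u N = sqrt (1 + (real N powr q - 1) / q)"
      using R_eq eventually_ge_at_top[of 1]
    proof eventually_elim
      case (elim N)
      have "real N powr (- 1 / 2) = 1 / sqrt (real N)"
        using elim(2) by (simp add: powr_minus_divide powr_half_sqrt)
      then show ?case
        using 1 elim by (simp add: rate_def q_def real_sqrt_divide)
    qed
    ultimately have "(\<lambda>N. R N u / rate u N) \<longlonglongrightarrow> sqrt (1 - 1 / q)"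
      by (simp add: tendsto_cong)
    moreover have "sqrt (1 - 1 / q) > 0" using q by (simp add: field_simps)
    ultimately show ?thesis by blast
  next
    case 2
    have "(\<lambda>N. sqrt ((1 + ln (real N)) / real N) / sqrt (ln (real N) / real N)) \<longlonglongrightarrow> 1"
      by real_asymp
    moreover have "\<forall>\<^sub>F N in sequentially. R N u / rate u N =
        sqrt ((1 + ln (real N)) / real N) / sqrt (ln (real N) / real N)"
      using R_eq unfolding 2 by eventually_elim (simp add: rate_def)
    ultimately have "(\<lambda>N. R N u / rate u N) \<longlonglongrightarrow> 1"
      by (simp add: tendsto_cong)
    then show ?thesis by (intro exI[of _ 1]) simp
  next
    case 3
    define q where "q = 3 - 4 * u"
    have q: "q > 0" "1 - 2 * u = (q - 1) / 2" using 3 by (auto simp: q_def)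
    have "(\<lambda>N. sqrt ((1 + (real N powr q - 1) / q) / real N) / real N powr ((q - 1) / 2)) \<longlonglongrightarrow> inverse q powr (1 / 2)"
      using q(1) by real_asymp
    moreover have "\<forall>\<^sub>F N in sequentially. R N u / rate u N =
        sqrt ((1 + (real N powr q - 1) / q) / real N) / real N powr ((q - 1) / 2)"
      using R_eq by eventually_elim (use 3 in \<open>simp add: rate_def q_def[symmetric] q(2)\<close>)
    ultimately have "(\<lambda>N. R N u / rate u N) \<longlonglongrightarrow> inverse q powr (1 / 2)"
      by (simp add: tendsto_cong)
    moreover have "inverse q powr (1 / 2) > 0" using q by simp
    ultimately show ?thesis by blast
  qed
qed

section \<open>Consistency of the estimator\<close>

lemma hseq_bounds:
  assumes "1 \<le> n"
  shows "sqrt (real n) / 2 \<le> real (hseq n)" "real (hseq n) \<le> sqrt (real n)" "1 \<le> hseq n" "hseq n \<le> n"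
proof -
  have s: "1 \<le> sqrt (real n)" using assms by simp
  have f: "1 \<le> \<lfloor>sqrt (real n)\<rfloor>" using s by (simp add: le_floor_iff)
  then have h: "real (hseq n) = of_int \<lfloor>sqrt (real n)\<rfloor>" by (simp add: hseq_def)
  show le: "real (hseq n) \<le> sqrt (real n)" unfolding h by simp
  have "sqrt (real n) * 1 \<le> sqrt (real n) * sqrt (real n)"
    by (rule mult_left_mono) (use s in auto)
  then show "hseq n \<le> n" using le by simp
  have "sqrt (real n) < of_int \<lfloor>sqrt (real n)\<rfloor> + 1" by (rule real_of_int_floor_add_one_gt)
  moreover have "(1::real) \<le> of_int \<lfloor>sqrt (real n)\<rfloor>" using f by simp
  ultimately show "sqrt (real n) / 2 \<le> real (hseq n)" unfolding h by linarith
  show "1 \<le> hseq n" using f by (simp add: hseq_def le_nat_iff)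
qed

lemma filterlim_hseq: "filterlim hseq sequentially sequentially"
proof -
  have "filterlim (\<lambda>n. sqrt (real n) / 2) at_top sequentially" by real_asymp
  moreover have "\<forall>\<^sub>F n in sequentially. sqrt (real n) / 2 \<le> real (hseq n)"
    using eventually_ge_at_top[of 1] by eventually_elim (rule hseq_bounds)
  ultimately have "filterlim (\<lambda>n. real (hseq n)) at_top sequentially"
    by (rule filterlim_at_top_mono)
  then show ?thesis by (simp add: filterlim_sequentially_iff_filterlim_real)
qed

lemma vrate_pos:
  assumes "1 \<le> h" "h \<le> n"
  shows "0 < vrate b n h"
proof -
  have "0 < real h / real n" "0 \<le> ln (real n / real h)" using assms by auto
  then have "0 < real h / real n * (1 + ln (real n / real h))"
    by (intro mult_pos_pos) auto
  then have "0 < sqrt (real h / real n * (1 + ln (real n / real h)))"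
    by (simp only: real_sqrt_gt_0_iff)
  then show ?thesis unfolding vrate_def using assms by (simp only: split: if_split) simp
qed

lemma vrate_hseq_pos: "1 \<le> n \<Longrightarrow> 0 < vrate b n (hseq n)"
  by (intro vrate_pos hseq_bounds)

text \<open>
  As \<open>hseq n\<close> has the order of \<open>sqrt n\<close>, both terms of the rate are bounded by negative powers
  of \<open>n\<close>, up to a logarithm for \<open>b = 3 / 4\<close>, and these absorb the factor \<open>ln n\<close>. The floor in \<open>hseq\<close>
  is removed by the two-sided bound with \<open>sqrt n\<close>, after which the limit is routine.
\<close>

lemma estimation_rate_log_limit:
  assumes "1 / 2 < b" "0 < \<delta>"
  shows "(\<lambda>n. (real (hseq n) powr (- \<delta>) + vrate b n (hseq n)) * ln (real n)) \<longlonglongrightarrow> 0"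
proof -
  define w where "w x = (if b < 3 / 4 then (1 / sqrt x) powr (2 * b - 1)
      else if b = 3 / 4 then sqrt (1 / sqrt x * (1 + ln (2 * sqrt x))) else sqrt (1 / sqrt x))" for x :: real
  have w: "(\<lambda>n. ((sqrt (real n) / 2) powr (- \<delta>) + w (real n)) * ln (real n)) \<longlonglongrightarrow> 0"
  proof -
    have "(\<lambda>n. (sqrt (real n) / 2) powr (- \<delta>) * ln (real n)) \<longlonglongrightarrow> 0"
      using assms(2) by real_asymp
    moreover have "(\<lambda>n. w (real n) * ln (real n)) \<longlonglongrightarrow> 0"
    proof -
      define q where "q = 2 * b - 1"
      have q: "0 < q" using assms(1) by (simp add: q_def)
      have "(\<lambda>n. (1 / sqrt (real n)) powr q * ln (real n)) \<longlonglongrightarrow> 0"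
        using q by real_asymp
      moreover have "(\<lambda>n. sqrt (1 / sqrt (real n) * (1 + ln (2 * sqrt (real n)))) * ln (real n)) \<longlonglongrightarrow> 0"
        by real_asymp
      moreover have "(\<lambda>n. sqrt (1 / sqrt (real n)) * ln (real n)) \<longlonglongrightarrow> 0"
        by real_asymp
      ultimately show ?thesis
        unfolding w_def q_def by (cases "b < 3 / 4"; cases "b = 3 / 4") simp_all
    qed
    ultimately have "(\<lambda>n. (sqrt (real n) / 2) powr (- \<delta>) * ln (real n) + w (real n) * ln (real n)) \<longlonglongrightarrow> 0 + 0"
      by (rule tendsto_add)
    then show ?thesis by (simp add: distrib_right)
  qed
  show ?thesis
  proof (rule tendsto_sandwich[OF _ _ tendsto_const w])
    show "\<forall>\<^sub>F n in sequentially. 0 \<le> (real (hseq n) powr (- \<delta>) + vrate b n (hseq n)) * ln (real n)"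
      using eventually_ge_at_top[of 1] by eventually_elim (simp add: vrate_hseq_pos less_imp_le)
    show "\<forall>\<^sub>F n in sequentially. (real (hseq n) powr (- \<delta>) + vrate b n (hseq n)) * ln (real n)
        \<le> ((sqrt (real n) / 2) powr (- \<delta>) + w (real n)) * ln (real n)"
      using eventually_ge_at_top[of 1]
    proof eventually_elim
      case (elim n)
      note h = hseq_bounds[OF elim]
      have ratio: "real (hseq n) / real n \<le> 1 / sqrt (real n)"
        using divide_right_mono[OF h(2), of "real n"] by (simp add: sqrt_divide_self_eq inverse_eq_divide)
      have hn: "real (hseq n) \<le> real n"
        using h(4) by simp
      have inv: "real n / real (hseq n) \<le> 2 * sqrt (real n)"
      proof -
        have "real n = sqrt (real n) * sqrt (real n)" by simp
        also have "\<dots> \<le> sqrt (real n) * (2 * real (hseq n))"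
          using h(1) by (intro mult_left_mono) auto
        finally show ?thesis using h(3) by (simp add: divide_simps mult_ac)
      qed
      have "vrate b n (hseq n) \<le> w (real n)"
      proof -
        have 1: "(real (hseq n) / real n) powr (2 * b - 1) \<le> (1 / sqrt (real n)) powr (2 * b - 1)"
          by (rule powr_mono2) (use assms ratio in auto)
        have l: "1 \<le> real n / real (hseq n)" using hn h(3) by simp
        have "ln (real n / real (hseq n)) \<le> ln (2 * sqrt (real n))"
          using l inv by (intro ln_mono) auto
        then have 2: "sqrt (real (hseq n) / real n * (1 + ln (real n / real (hseq n))))
            \<le> sqrt (1 / sqrt (real n) * (1 + ln (2 * sqrt (real n))))"
          using l by (intro real_sqrt_le_mono mult_mono ratio) auto
        have 3: "sqrt (real (hseq n) / real n) \<le> sqrt (1 / sqrt (real n))"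
          by (intro real_sqrt_le_mono ratio)
        show ?thesis unfolding vrate_def w_def using 1 2 3 by simp
      qed
      moreover have "real (hseq n) powr (- \<delta>) \<le> (sqrt (real n) / 2) powr (- \<delta>)"
        by (rule powr_mono2') (use h(1) elim assms in auto)
      ultimately show ?case using elim by (intro mult_right_mono add_mono) auto
    qed
  qed
qed

lemma abs_ln_le:
  fixes x :: real
  assumes "\<bar>x - 1\<bar> \<le> e" "e \<le> 1 / 2"
  shows "0 < x" "\<bar>ln x\<bar> \<le> 2 * e"
proof -
  show "0 < x" using assms by linarith
  have "\<bar>ln (1 + (x - 1)) - (x - 1)\<bar> \<le> 2 * (x - 1)\<^sup>2"
    by (rule abs_ln_one_plus_x_minus_x_bound) (use assms in auto)
  moreover have "2 * (x - 1)\<^sup>2 \<le> \<bar>x - 1\<bar>"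
  proof -
    have "2 * (x - 1)\<^sup>2 = (2 * \<bar>x - 1\<bar>) * \<bar>x - 1\<bar>" by (simp add: power2_eq_square abs_mult_self_eq mult.assoc)
    also have "\<dots> \<le> 1 * \<bar>x - 1\<bar>" by (rule mult_right_mono) (use assms in auto)
    finally show ?thesis by simp
  qed
  ultimately show "\<bar>ln x\<bar> \<le> 2 * e" using assms(1) by simp
qed

text \<open>
  If all three relative errors are small, the two statistics are positive, so the default value
  \<open>3 / 4\<close> does not occur, and the logarithm of \<open>Q\<^sub>2\<^sub>h / Q\<^sub>h\<close> is \<open>(3 - 2 * b) * ln 2\<close> plus the
  logarithms of three factors close to 1.
\<close>

lemma betahat_error:
  assumes V: "0 < V1" "0 < V2"
    and Q1: "\<bar>Qhat w n h - V1\<bar> \<le> e * V1" and Q2: "\<bar>Qhat w n (2 * h) - V2\<bar> \<le> e * V2" and e: "e \<le> 1 / 2"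
    and ratio: "\<bar>V2 / (2 powr (3 - 2 * b) * V1) - 1\<bar> \<le> r" and r: "r \<le> 1 / 2"
  shows "\<bar>betahat w n h - b\<bar> \<le> 4 * e + 2 * r"
proof -
  define x1 x2 y where "x1 = Qhat w n h / V1" and "x2 = Qhat w n (2 * h) / V2"
    and "y = V2 / (2 powr (3 - 2 * b) * V1)"
  have "\<bar>x1 - 1\<bar> = \<bar>Qhat w n h - V1\<bar> / V1"
    using V by (simp add: x1_def field_simps)
  also have "\<dots> \<le> e" using Q1 V by (simp add: pos_divide_le_eq)
  finally have x1: "0 < x1" "\<bar>ln x1\<bar> \<le> 2 * e" using abs_ln_le e by blast+
  have "\<bar>x2 - 1\<bar> = \<bar>Qhat w n (2 * h) - V2\<bar> / V2"
    using V by (simp add: x2_def field_simps)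
  also have "\<dots> \<le> e" using Q2 V by (simp add: pos_divide_le_eq)
  finally have x2: "0 < x2" "\<bar>ln x2\<bar> \<le> 2 * e" using abs_ln_le e by blast+
  have y: "0 < y" "\<bar>ln y\<bar> \<le> 2 * r" using abs_ln_le[OF ratio r] by (auto simp: y_def)
  have Q: "Qhat w n h = x1 * V1" "Qhat w n (2 * h) = x2 * V2"
    using V by (auto simp: x1_def x2_def)
  have "Qhat w n (2 * h) / Qhat w n h = x2 * y * 2 powr (3 - 2 * b) / x1"
    using V x1 unfolding Q by (simp add: y_def)
  also have "ln \<dots> = ln x2 + ln y + (3 - 2 * b) * ln 2 - ln x1"
    using x1 x2 y by (simp add: ln_div ln_mult ln_powr)
  finally have "ln (Qhat w n (2 * h) / Qhat w n h) = ln x2 + ln y + (3 - 2 * b) * ln 2 - ln x1" .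
  moreover have "betahat w n h = 3 / 2 - ln (Qhat w n (2 * h) / Qhat w n h) / (2 * ln 2)"
    using V x1(1) x2(1) by (simp add: betahat_def Q)
  ultimately have "betahat w n h - b = (ln x1 - ln x2 - ln y) / (2 * ln 2)"
    by (simp add: field_simps)
  moreover have "\<bar>z / (2 * ln 2)\<bar> \<le> \<bar>z\<bar> / 1" for z :: real
  proof -
    have "1 \<le> 2 * ln (2::real)" using ln2_ge_two_thirds by simp
    then have "\<bar>z\<bar> / (2 * ln 2) \<le> \<bar>z\<bar> / 1" by (intro frac_le) auto
    then show ?thesis by (simp add: abs_divide)
  qed
  ultimately have "\<bar>betahat w n h - b\<bar> \<le> \<bar>ln x1 - ln x2 - ln y\<bar>"
    by simp
  then show ?thesis using x1(2) x2(2) y(2) by linarith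
qed

lemma Qhat_measurable:
  assumes [measurable]: "\<And>t. W t \<in> borel_measurable M"
  shows "(\<lambda>\<omega>. Qhat (\<lambda>t. W t \<omega>) n l) \<in> borel_measurable M"
  unfolding Qhat_def by measurable

lemma betahat_measurable:
  assumes W: "\<And>t. W t \<in> borel_measurable M"
  shows "(\<lambda>\<omega>. betahat (\<lambda>t. W t \<omega>) n h) \<in> borel_measurable M"
proof -
  note [measurable] = Qhat_measurable[of W M, OF W]
  show ?thesis unfolding betahat_def by measurable
qed

context prob_space
begin

text \<open>
  Chebyshev's inequality with the second moment as a nonnegative integral, which is the form in which
  Fatou's lemma delivers it.
\<close>

lemma second_moment_tail:
  assumes [measurable]: "f \<in> borel_measurable M" and t: "0 < t" and s: "0 \<le> s"
    and f: "(\<integral>\<^sup>+\<omega>. ennreal ((f \<omega>)\<^sup>2) \<partial>M) \<le> ennreal s"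
  shows "prob {\<omega> \<in> space M. \<bar>f \<omega>\<bar> > t} \<le> s / t\<^sup>2"
proof -
  have "emeasure M {\<omega> \<in> space M. \<bar>f \<omega>\<bar> > t}
      \<le> emeasure M {\<omega> \<in> space M. 1 \<le> ennreal (1 / t\<^sup>2) * ennreal ((f \<omega>)\<^sup>2)}"
  proof (rule emeasure_mono)
    show "{\<omega> \<in> space M. \<bar>f \<omega>\<bar> > t} \<subseteq> {\<omega> \<in> space M. 1 \<le> ennreal (1 / t\<^sup>2) * ennreal ((f \<omega>)\<^sup>2)}"
    proof clarify
      fix \<omega> assume "t < \<bar>f \<omega>\<bar>"
      then have "t\<^sup>2 \<le> (f \<omega>)\<^sup>2" using t power_mono[of t "\<bar>f \<omega>\<bar>" 2] by simp
      then have "1 \<le> 1 / t\<^sup>2 * (f \<omega>)\<^sup>2" using t by simp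
      then show "1 \<le> ennreal (1 / t\<^sup>2) * ennreal ((f \<omega>)\<^sup>2)"
        by (subst ennreal_mult[symmetric]) (auto simp: ennreal_1[symmetric] simp del: ennreal_1)
    qed
  qed measurable
  also have "\<dots> \<le> ennreal (1 / t\<^sup>2) * (\<integral>\<^sup>+\<omega>. ennreal ((f \<omega>)\<^sup>2) * indicator (space M) \<omega> \<partial>M)"
    by (rule nn_integral_Markov_inequality) auto
  also have "(\<integral>\<^sup>+\<omega>. ennreal ((f \<omega>)\<^sup>2) * indicator (space M) \<omega> \<partial>M) = (\<integral>\<^sup>+\<omega>. ennreal ((f \<omega>)\<^sup>2) \<partial>M)"
    by (rule nn_integral_cong) simp
  also have "ennreal (1 / t\<^sup>2) * \<dots> \<le> ennreal (1 / t\<^sup>2) * ennreal s"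
    by (intro mult_left_mono f) simp
  also have "\<dots> = ennreal (s / t\<^sup>2)"
    using s by (simp add: ennreal_mult[symmetric])
  finally show ?thesis
    using s by (simp add: emeasure_eq_measure)
qed

lemma bounded_in_prob_imp_tendsto:
  assumes X: "bounded_in_prob M X r" and lim: "(\<lambda>n. r n * s n) \<longlonglongrightarrow> 0"
    and s: "\<forall>\<^sub>F n in sequentially. 0 < s n"
  shows "tendsto_in_prob M (\<lambda>n \<omega>. X n \<omega> * s n) 0"
  unfolding tendsto_in_prob_def
proof (intro conjI allI impI)
  have [measurable]: "X n \<in> borel_measurable M" for n using X by (simp add: bounded_in_prob_def)
  show "(\<lambda>\<omega>. X n \<omega> * s n) \<in> borel_measurable M" for n by measurable
  fix e :: real assume e: "0 < e"
  show "(\<lambda>n. prob {\<omega> \<in> space M. \<bar>X n \<omega> * s n - 0\<bar> > e}) \<longlonglongrightarrow> 0"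
  proof (rule LIMSEQ_I)
    fix \<eta> :: real assume \<eta>: "0 < \<eta>"
    then obtain C where C: "0 < C"
      "\<forall>\<^sub>F n in sequentially. prob {\<omega> \<in> space M. \<bar>X n \<omega>\<bar> > C * r n} \<le> \<eta> / 2"
      using X half_gt_zero[OF \<eta>] unfolding bounded_in_prob_def by blast
    have "(\<lambda>n. C * (r n * s n)) \<longlonglongrightarrow> C * 0" by (intro tendsto_intros lim)
    then have "\<forall>\<^sub>F n in sequentially. C * (r n * s n) < e"
      using e by (intro order_tendstoD(2)) auto
    with C(2) s have "\<forall>\<^sub>F n in sequentially. norm (prob {\<omega> \<in> space M. \<bar>X n \<omega> * s n - 0\<bar> > e} - 0) < \<eta>"
    proof eventually_elim
      case (elim n)
      have "{\<omega> \<in> space M. \<bar>X n \<omega> * s n - 0\<bar> > e} \<subseteq> {\<omega> \<in> space M. \<bar>X n \<omega>\<bar> > C * r n}"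
      proof clarify
        fix \<omega> assume "e < \<bar>X n \<omega> * s n - 0\<bar>"
        moreover have "\<bar>X n \<omega> * s n - 0\<bar> = \<bar>X n \<omega>\<bar> * s n" using elim by (simp add: abs_mult)
        ultimately have "C * r n * s n < \<bar>X n \<omega>\<bar> * s n" using elim by (simp only: mult.assoc)
        then show "C * r n < \<bar>X n \<omega>\<bar>"
          using elim mult_less_cancel_right_pos[of "s n" "C * r n" "\<bar>X n \<omega>\<bar>"] by blast
      qed
      then have "prob {\<omega> \<in> space M. \<bar>X n \<omega> * s n - 0\<bar> > e} \<le> prob {\<omega> \<in> space M. \<bar>X n \<omega>\<bar> > C * r n}"
        by (rule finite_measure_mono) measurable
      then show ?case using elim \<eta> by simp
    qed
    then show "\<exists>no. \<forall>n\<ge>no. norm (prob {\<omega> \<in> space M. \<bar>X n \<omega> * s n - 0\<bar> > e} - 0) < \<eta>"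
      by (simp add: eventually_sequentially)
  qed
qed

text \<open>
  Outside an event of small probability \<open>\<bar>B n - b\<bar> * ln n\<close> is at most \<open>ln (1 + e) / 2\<close>. As \<open>m n \<le> n\<close>, the
  perturbation factor \<open>(m n) powr (2 * \<bar>B n - b\<bar>)\<close> is then at most \<open>1 + e\<close>, in both directions.
\<close>

lemma R_ratio_tendsto:
  assumes B: "\<And>n. B n \<in> borel_measurable M"
    and lim: "tendsto_in_prob M (\<lambda>n \<omega>. (B n \<omega> - b) * ln (real n)) 0"
    and m: "\<forall>\<^sub>F n in sequentially. 1 \<le> m n \<and> m n \<le> n"
  shows "tendsto_in_prob M (\<lambda>n \<omega>. R (m n) (B n \<omega>) / R (m n) b) 1"
  unfolding tendsto_in_prob_def
proof (intro conjI allI impI)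
  note [measurable] = B
  show "(\<lambda>\<omega>. R (m n) (B n \<omega>) / R (m n) b) \<in> borel_measurable M" for n by measurable
  fix e :: real assume e: "0 < e"
  \<comment> \<open>Chosen so that exp (2 * \<eta>) = 1 + e.\<close>
  define \<eta> where "\<eta> = ln (1 + e) / 2"
  have \<eta>: "0 < \<eta>" using e by (simp add: \<eta>_def)
  have lim_\<eta>: "(\<lambda>n. prob {\<omega> \<in> space M. \<bar>(B n \<omega> - b) * ln (real n) - 0\<bar> > \<eta>}) \<longlonglongrightarrow> 0"
    using lim \<eta> by (simp add: tendsto_in_prob_def)
  show "(\<lambda>n. prob {\<omega> \<in> space M. \<bar>R (m n) (B n \<omega>) / R (m n) b - 1\<bar> > e}) \<longlonglongrightarrow> 0"
  proof (rule tendsto_sandwich[OF _ _ tendsto_const lim_\<eta>])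
    show "\<forall>\<^sub>F n in sequentially. prob {\<omega> \<in> space M. \<bar>R (m n) (B n \<omega>) / R (m n) b - 1\<bar> > e}
        \<le> prob {\<omega> \<in> space M. \<bar>(B n \<omega> - b) * ln (real n) - 0\<bar> > \<eta>}"
      using m
    proof eventually_elim
      case (elim n)
      have "{\<omega> \<in> space M. \<bar>R (m n) (B n \<omega>) / R (m n) b - 1\<bar> > e}
          \<subseteq> {\<omega> \<in> space M. \<bar>(B n \<omega> - b) * ln (real n) - 0\<bar> > \<eta>}"
      proof clarify
        fix \<omega> assume far: "e < \<bar>R (m n) (B n \<omega>) / R (m n) b - 1\<bar>"
        show "\<eta> < \<bar>(B n \<omega> - b) * ln (real n) - 0\<bar>"
        proof (rule ccontr)
          assume "\<not> ?thesis"
          moreover have "\<bar>B n \<omega> - b\<bar> * ln (real (m n)) \<le> \<bar>B n \<omega> - b\<bar> * ln (real n)"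
            using elim by (intro mult_left_mono) auto
          ultimately have "2 * \<bar>B n \<omega> - b\<bar> * ln (real (m n)) \<le> ln (1 + e)"
            using elim by (simp add: abs_mult \<eta>_def)
          then have "exp (2 * \<bar>B n \<omega> - b\<bar> * ln (real (m n))) \<le> exp (ln (1 + e))" by simp
          then have x: "real (m n) powr (2 * \<bar>B n \<omega> - b\<bar>) \<le> 1 + e"
            using elim e by (simp add: powr_def)
          note Rp = R_pos[of "m n"]
          have 1: "R (m n) (B n \<omega>) \<le> (1 + e) * R (m n) b"
            by (rule order_trans[OF R_perturbation[of _ _ b] mult_right_mono])
              (use x Rp[of b] elim in auto)
          have 2: "R (m n) b \<le> (1 + e) * R (m n) (B n \<omega>)"
            by (rule order_trans[OF R_perturbation[of _ _ "B n \<omega>"] mult_right_mono])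
              (use x Rp[of "B n \<omega>"] elim in \<open>auto simp: abs_minus_commute\<close>)
          define \<rho> where "\<rho> = R (m n) (B n \<omega>) / R (m n) b"
          have \<rho>: "0 < \<rho>" "\<rho> \<le> 1 + e" "1 \<le> (1 + e) * \<rho>"
            using 1 2 Rp[of b] Rp[of "B n \<omega>"] elim by (auto simp: \<rho>_def pos_divide_le_eq pos_le_divide_eq)
          have "1 - e \<le> \<rho>"
          proof (cases "e \<le> 1")
            case True
            \<comment> \<open>From 1 \<le> (1 + e) * \<rho>, since (1 - e) * (1 + e) \<le> 1.\<close>
            have "(1 - e) * 1 \<le> (1 - e) * ((1 + e) * \<rho>)"
              by (rule mult_left_mono) (use True \<rho> in auto)
            also have "\<dots> = \<rho> - e\<^sup>2 * \<rho>" by (simp add: algebra_simps power2_eq_square)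
            also have "\<dots> \<le> \<rho>" using \<rho> by simp
            finally show ?thesis by simp
          qed (use \<rho> in linarith)
          then show False using far \<rho> unfolding \<rho>_def by linarith
        qed
      qed
      then show ?case by (rule finite_measure_mono) measurable
    qed
  qed simp
qed

end

text \<open>
  Chebyshev's inequality puts both statistics within a relative distance \<open>D * vrate\<close> of the block
  variances, outside an event of probability at most \<open>2 * C1 / D\<^sup>2\<close> with \<open>C1\<close> independent of \<open>n\<close>. On the
  complement the deterministic lemma \<open>betahat_error\<close> applies as soon as the rate is small.
\<close>

lemma (in prob_space) betahat_bounded_in_prob:
  fixes \<epsilon> W :: "int \<Rightarrow> 'a \<Rightarrow> real"
  assumes indep: "indep_vars (\<lambda>_. borel) \<epsilon> UNIV"
    and normal: "\<And>t. distributed M lborel (\<epsilon> t) std_normal_density"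
    and series: "\<And>t. AE \<omega> in M. (\<lambda>j. a j * \<epsilon> (t - int j) \<omega>) sums W t \<omega>"
    and W: "\<And>t. W t \<in> borel_measurable M"
    and coeffs: "power_law_coefficients a b c \<delta> K"
  shows "bounded_in_prob M (\<lambda>n \<omega>. betahat (\<lambda>t. W t \<omega>) n (hseq n) - b)
    (\<lambda>n. real (hseq n) powr (- \<delta>) + vrate b n (hseq n))"
proof -
  interpret power_law_coefficients a b c \<delta> K by (rule coeffs)
  note [measurable] = betahat_measurable[of W M, OF W] Qhat_measurable[of W M, OF W]
  let ?V = "\<lambda>l. block_cov a l 0"
  let ?S = "\<lambda>n l. 2 / (real n - real l + 1)\<^sup>2 *
      (\<Sum>i\<in>{0..int n - int l}. \<Sum>j\<in>{0..int n - int l}. (block_cov a l (i - j))\<^sup>2)"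
  let ?r = "\<lambda>n. real (hseq n) powr (- \<delta>)" and ?v = "\<lambda>n. vrate b n (hseq n)"
  obtain C1 where C1: "0 \<le> C1"
    "\<forall>\<^sub>F h in sequentially. \<forall>n l. 4 * h \<le> n \<longrightarrow> l \<in> {h, 2 * h} \<longrightarrow> 0 < ?V l \<and>
      ?S n l \<le> C1 * (vrate b n h)\<^sup>2 * (?V l)\<^sup>2"
    by (rule block_variance_bound) (rule that)
  obtain K4 where K4: "0 \<le> K4"
    "\<And>l. \<bar>?V (2 * l) - 2 powr (3 - 2 * b) * ?V l\<bar> \<le> K4 * real l powr (3 - 2 * b - \<delta>)"
    by (rule block_variance_double) (rule that)
  obtain \<kappa> where \<kappa>: "0 < \<kappa>" "\<forall>\<^sub>F l in sequentially. \<kappa> * real l powr (3 - 2 * b) \<le> ?V l"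
    by (rule block_variance_lower) (rule that)
  define K' where "K' = K4 / (2 powr (3 - 2 * b) * \<kappa>)"
  have K': "0 \<le> K'" using K4 \<kappa> by (simp add: K'_def)
  have rv: "(\<lambda>n. ?r n + ?v n) \<longlonglongrightarrow> 0"
  proof (rule tendsto_sandwich[OF _ _ tendsto_const estimation_rate_log_limit[OF b(1) \<delta>(1)]])
    show "\<forall>\<^sub>F n in sequentially. 0 \<le> ?r n + ?v n"
      using eventually_ge_at_top[of 1] by eventually_elim (simp add: vrate_hseq_pos less_imp_le)
    have "\<forall>\<^sub>F n in sequentially. 1 \<le> ln (real n)" by real_asymp
    then show "\<forall>\<^sub>F n in sequentially. ?r n + ?v n \<le> (?r n + ?v n) * ln (real n)"
      using eventually_ge_at_top[of 1]
    proof eventually_elim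
      case (elim n)
      then show ?case
        using mult_left_mono[OF elim(1), of "?r n + ?v n"] vrate_hseq_pos[of n b] by simp
    qed
  qed
  have small: "\<forall>\<^sub>F n in sequentially. D * (?r n + ?v n) < 1 / 2" for D
  proof -
    have "(\<lambda>n. D * (?r n + ?v n)) \<longlonglongrightarrow> D * 0" by (intro tendsto_mult tendsto_const rv)
    then show ?thesis by (intro order_tendstoD(2)) auto
  qed
  have "\<exists>C>0. \<forall>\<^sub>F n in sequentially.
      prob {\<omega> \<in> space M. \<bar>betahat (\<lambda>t. W t \<omega>) n (hseq n) - b\<bar> > C * (?r n + ?v n)} \<le> e" if e: "0 < e" for e
  proof -
    \<comment> \<open>Makes the exceptional probability 2 * C1 / D^2 at most e; the summand 1 keeps D positive.\<close>
    define D where "D = sqrt (2 * C1 / e) + 1"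
    have D: "1 \<le> D" using C1 e by (simp add: D_def)
    have D2: "2 * (C1 / D\<^sup>2) \<le> e"
    proof -
      have "2 * C1 / e = (sqrt (2 * C1 / e))\<^sup>2" using C1 e by simp
      also have "\<dots> \<le> D\<^sup>2" unfolding D_def by (rule power_mono) (use C1 e in auto)
      finally show ?thesis using e D by (simp add: field_simps)
    qed
    \<comment> \<open>The constants 4 and 2 are those of the deterministic error bound.\<close>
    define C where "C = 4 * D + 2 * K'"
    have C: "0 < C" using D K' by (simp add: C_def)
    have four: "\<forall>\<^sub>F n in sequentially. 4 * sqrt (real n) \<le> real n" by real_asymp
    have "\<forall>\<^sub>F n in sequentially.
      prob {\<omega> \<in> space M. \<bar>betahat (\<lambda>t. W t \<omega>) n (hseq n) - b\<bar> > C * (?r n + ?v n)} \<le> e"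
      using small[of D] small[of K'] four eventually_ge_at_top[of 1]
        eventually_compose_filterlim[OF C1(2) filterlim_hseq] eventually_compose_filterlim[OF \<kappa>(2) filterlim_hseq]
    proof eventually_elim
      case (elim n)
      define h where "h = hseq n"
      have h: "1 \<le> h" "4 * h \<le> n" using hseq_bounds[OF elim(4)] elim(3) by (auto simp: h_def)
      have v: "0 < vrate b n h" by (rule vrate_pos) (use h in auto)
      have V: "0 < ?V h" "0 < ?V (2 * h)" using elim(5) h by (auto simp: h_def)
      define A where "A l = {\<omega> \<in> space M. \<bar>Qhat (\<lambda>t. W t \<omega>) n l - ?V l\<bar> > D * vrate b n h * ?V l}" for l
      have A_meas [measurable]: "A l \<in> events" for l unfolding A_def by measurable
      have A: "prob (A l) \<le> C1 / D\<^sup>2" if l: "l \<in> {h, 2 * h}" for l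
      proof -
        have Vl: "0 < ?V l" using V l by auto
        have "(\<integral>\<^sup>+\<omega>. ennreal ((Qhat (\<lambda>t. W t \<omega>) n l - ?V l)\<^sup>2) \<partial>M) \<le> ennreal (?S n l)"
          by (rule Qhat_second_moment[OF indep normal series coeff_square_summable]) (use l h in auto)
        also have "\<dots> \<le> ennreal (C1 * (vrate b n h)\<^sup>2 * (?V l)\<^sup>2)"
          using elim(5) l h by (intro ennreal_leI) (auto simp: h_def)
        finally have "prob (A l) \<le> C1 * (vrate b n h)\<^sup>2 * (?V l)\<^sup>2 / (D * vrate b n h * ?V l)\<^sup>2"
          unfolding A_def by (intro second_moment_tail) (use D v Vl C1 in auto)
        also have "\<dots> = C1 / D\<^sup>2" using v Vl by (simp add: power_mult_distrib)
        finally show ?thesis .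
      qed
      have "{\<omega> \<in> space M. \<bar>betahat (\<lambda>t. W t \<omega>) n (hseq n) - b\<bar> > C * (?r n + ?v n)} \<subseteq> A h \<union> A (2 * h)"
      proof (intro subsetI, rule ccontr)
        fix \<omega> assume \<omega>: "\<omega> \<in> {\<omega> \<in> space M. \<bar>betahat (\<lambda>t. W t \<omega>) n (hseq n) - b\<bar> > C * (?r n + ?v n)}"
          and "\<omega> \<notin> A h \<union> A (2 * h)"
        then have Q: "\<bar>Qhat (\<lambda>t. W t \<omega>) n h - ?V h\<bar> \<le> D * vrate b n h * ?V h"
          "\<bar>Qhat (\<lambda>t. W t \<omega>) n (2 * h) - ?V (2 * h)\<bar> \<le> D * vrate b n h * ?V (2 * h)"
          by (auto simp: A_def)
        have dv: "D * vrate b n h \<le> 1 / 2"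
        proof -
          have "0 \<le> D * real h powr (- \<delta>)" using D by simp
          then show ?thesis using elim(1) unfolding h_def[symmetric] distrib_left by linarith
        qed
        have kr: "K' * real h powr (- \<delta>) \<le> 1 / 2"
        proof -
          have "0 \<le> K' * vrate b n h" using K' v by simp
          then show ?thesis using elim(2) unfolding h_def[symmetric] distrib_left by linarith
        qed
        have ratio: "\<bar>?V (2 * h) / (2 powr (3 - 2 * b) * ?V h) - 1\<bar> \<le> K' * real h powr (- \<delta>)"
        proof -
          define P :: real where "P = 2 powr (3 - 2 * b)"
          have P: "0 < P" by (simp add: P_def)
          have PV: "0 < P * ?V h" using P V by simp
          then have "?V (2 * h) / (P * ?V h) - 1 = (?V (2 * h) - P * ?V h) / (P * ?V h)"
            using P V by (simp add: diff_divide_distrib)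
          then have "\<bar>?V (2 * h) / (P * ?V h) - 1\<bar> = \<bar>?V (2 * h) - P * ?V h\<bar> / (P * ?V h)"
            using PV by (simp only: abs_divide abs_of_pos)
          also have "\<dots> \<le> K4 * real h powr (3 - 2 * b - \<delta>) / (P * (\<kappa> * real h powr (3 - 2 * b)))"
            using K4(2)[of h] elim(6) P \<kappa> h K4(1) V
            by (intro frac_le mult_left_mono mult_pos_pos) (auto simp: h_def P_def)
          also have "\<dots> = K' * (real h powr (3 - 2 * b - \<delta>) / real h powr (3 - 2 * b))"
            by (simp add: K'_def P_def)
          also have "real h powr (3 - 2 * b - \<delta>) / real h powr (3 - 2 * b) = real h powr (- \<delta>)"
            by (simp add: powr_diff[symmetric])
          finally show ?thesis unfolding P_def .
        qed
        have "\<bar>betahat (\<lambda>t. W t \<omega>) n h - b\<bar> \<le> 4 * (D * vrate b n h) + 2 * (K' * real h powr (- \<delta>))"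
          by (rule betahat_error[OF V Q dv ratio kr])
        also have "\<dots> \<le> C * (real h powr (- \<delta>) + vrate b n h)"
          using D K' v by (simp add: C_def algebra_simps)
        finally show False using \<omega> by (simp add: h_def)
      qed
      then have "prob {\<omega> \<in> space M. \<bar>betahat (\<lambda>t. W t \<omega>) n (hseq n) - b\<bar> > C * (?r n + ?v n)}
          \<le> prob (A h \<union> A (2 * h))"
        by (rule finite_measure_mono) measurable
      also have "\<dots> \<le> prob (A h) + prob (A (2 * h))"
        by (rule measure_Un_le) measurable
      also have "\<dots> \<le> C1 / D\<^sup>2 + C1 / D\<^sup>2"
        by (intro add_mono A) auto
      also have "\<dots> \<le> e" using D2 by simp
      finally show ?case .
    qed
    then show ?thesis using C by blast
  qed
  then show ?thesis unfolding bounded_in_prob_def by auto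
qed

text \<open>
  A Landau bound holds from some index on; the finitely many earlier values of \<open>g\<close> are absorbed by
  enlarging the constant.
\<close>

lemma power_law_coefficientsI:
  assumes "1 / 2 < b" "b < 1" "0 < \<delta>" "\<delta> < 1 - b" "\<delta> \<le> \<phi>" "0 < c"
    and g: "g \<in> O(\<lambda>j. real j powr (- \<phi>))" "\<And>j. 1 \<le> j \<Longrightarrow> a j = real j powr (- b) * (c + g j)"
  obtains K where "power_law_coefficients a b c \<delta> K"
proof -
  obtain C where C: "0 < C" "\<forall>\<^sub>F j in sequentially. norm (g j) \<le> C * norm (real j powr (- \<phi>))"
    using g(1) by (rule landau_o.bigE)
  then obtain j0 where j0: "\<And>j. j0 \<le> j \<Longrightarrow> \<bar>g j\<bar> \<le> C * real j powr (- \<phi>)"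
    by (auto simp: eventually_sequentially)
  define K where "K = C + (\<Sum>i<j0. \<bar>g i\<bar> * real i powr \<delta>)"
  have sum0: "0 \<le> (\<Sum>i<j0. \<bar>g i\<bar> * real i powr \<delta>)" by (simp add: sum_nonneg)
  have gK: "\<bar>g j\<bar> \<le> K * real j powr (- \<delta>)" if j: "1 \<le> j" for j
  proof (cases "j0 \<le> j")
    case True
    have "\<bar>g j\<bar> \<le> C * real j powr (- \<phi>)" using True by (rule j0)
    also have "\<dots> \<le> K * real j powr (- \<delta>)"
      using C(1) sum0 assms j by (intro mult_mono powr_mono) (auto simp: K_def)
    finally show ?thesis .
  next
    case False
    have "\<bar>g j\<bar> * real j powr \<delta> \<le> (\<Sum>i<j0. \<bar>g i\<bar> * real i powr \<delta>)"
      by (rule member_le_sum[of j _ "\<lambda>i. \<bar>g i\<bar> * real i powr \<delta>"]) (use False in auto)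
    also have "\<dots> \<le> K" using C(1) by (simp add: K_def)
    finally show ?thesis using j by (simp add: powr_minus_divide field_simps)
  qed
  have "power_law_coefficients a b c \<delta> K"
  proof
    fix j
    have "a (Suc j) - c * real (Suc j) powr (- b) = real (Suc j) powr (- b) * g (Suc j)"
      using g(2)[of "Suc j"] by (simp add: algebra_simps)
    also have "\<bar>\<dots>\<bar> \<le> real (Suc j) powr (- b) * (K * real (Suc j) powr (- \<delta>))"
      unfolding abs_mult using gK[of "Suc j"] by (intro mult_mono) auto
    also have "\<dots> = K * real (Suc j) powr (- b - \<delta>)"
      by (simp add: powr_diff powr_minus_divide)
    finally show "\<bar>a (Suc j) - c * real (Suc j) powr (- b)\<bar> \<le> K * real (Suc j) powr (- b - \<delta>)" .
  qed (use assms in auto)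
  then show ?thesis by (rule that)
qed

lemma bseq_range:
  assumes "0 < \<zeta>" "\<zeta> < 1" "1 \<le> n"
  shows "1 \<le> bseq \<zeta> n \<and> bseq \<zeta> n \<le> n"
proof
  have "1 \<le> real n powr \<zeta>" by (rule ge_one_powr_ge_zero) (use assms in auto)
  then show "1 \<le> bseq \<zeta> n" by (simp add: bseq_def le_nat_iff le_floor_iff)
  have "real n powr \<zeta> \<le> real n powr 1" by (rule powr_mono) (use assms in auto)
  then have "\<lfloor>real n powr \<zeta>\<rfloor> \<le> \<lfloor>real n\<rfloor>" by (intro floor_mono) simp
  then show "bseq \<zeta> n \<le> n" by (simp add: bseq_def nat_le_iff)
qed

theorem lemma10:
  fixes M :: "'a measure" and S :: "'x measure"
    and X :: "int \<Rightarrow> 'a \<Rightarrow> 'x" and Y W \<epsilon> :: "int \<Rightarrow> 'a \<Rightarrow> real"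
    and \<mu> :: "'x \<Rightarrow> real" and a :: "nat \<Rightarrow> real"
    and c \<beta> \<phi> \<zeta> :: real
  assumes "prob_space M"
    and "strictly_stationary M (S \<Otimes>\<^sub>M borel) (\<lambda>t \<omega>. (X t \<omega>, Y t \<omega>))"
    and "\<mu> \<in> borel_measurable S"
    and "\<And>t \<omega>. W t \<omega> = Y t \<omega> - \<mu> (X t \<omega>)"
    and "prob_space.indep_vars M (\<lambda>_. borel) \<epsilon> UNIV"
    and "\<And>t. distributed M lborel (\<epsilon> t) std_normal_density"
    and "\<And>t. AE \<omega> in M. (\<lambda>j. a j * \<epsilon> (t - int j) \<omega>) sums W t \<omega>"
    and "a 0 \<noteq> 0"
    and "c > 0" and "1 / 2 < \<beta>" and "\<beta> < 1"
    and "a \<sim>[at_top] (\<lambda>j. c * real j powr (- \<beta>))"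
    and "\<phi> > 0"
    and "\<exists>g. g \<in> O(\<lambda>j. real j powr (- \<phi>)) \<and> (\<forall>j\<ge>1. a j = real j powr (- \<beta>) * (c + g j))"
    and "0 < \<zeta>" and "\<zeta> < 1"
  shows
    "(\<forall>\<delta>. 0 < \<delta> \<and> \<delta> < min \<phi> (1 - \<beta>) \<longrightarrow>
        bounded_in_prob M (\<lambda>n \<omega>. betahat (\<lambda>t. W t \<omega>) n (hseq n) - \<beta>)
          (\<lambda>n. real (hseq n) powr (- \<delta>) + vrate \<beta> n (hseq n))) \<and>
     tendsto_in_prob M (\<lambda>n \<omega>. (betahat (\<lambda>t. W t \<omega>) n (hseq n) - \<beta>) * ln (real n)) 0 \<and>
     tendsto_in_prob M
       (\<lambda>n \<omega>. R (bseq \<zeta> n) (betahat (\<lambda>t. W t \<omega>) n (hseq n)) / R (bseq \<zeta> n) \<beta>) 1 \<and>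
     tendsto_in_prob M
       (\<lambda>n \<omega>. R n (betahat (\<lambda>t. W t \<omega>) n (hseq n)) / R n \<beta>) 1 \<and>
     (\<forall>u. 1 / 2 < u \<and> u < 1 \<longrightarrow> (\<exists>L>0. (\<lambda>N. R N u / rate u N) \<longlonglongrightarrow> L))"
proof -
  note stationary = assms(2) and \<mu> = assms(3) and W_def = assms(4) and indep = assms(5)
    and normal = assms(6) and series = assms(7) and c = assms(9) and \<beta> = assms(10,11)
    and \<phi> = assms(13) and \<zeta> = assms(15,16)
  interpret prob_space M by (rule assms(1))
  let ?B = "\<lambda>n \<omega>. betahat (\<lambda>t. W t \<omega>) n (hseq n)"
  obtain g where g: "g \<in> O(\<lambda>j. real j powr (- \<phi>))" "\<And>j. 1 \<le> j \<Longrightarrow> a j = real j powr (- \<beta>) * (c + g j)"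
    using assms(14) by blast
  have W [measurable]: "W t \<in> borel_measurable M" for t
  proof -
    have Z: "(\<lambda>\<omega>. (X t \<omega>, Y t \<omega>)) \<in> M \<rightarrow>\<^sub>M S \<Otimes>\<^sub>M borel"
      using stationary by (simp add: strictly_stationary_def)
    have "X t \<in> M \<rightarrow>\<^sub>M S" "Y t \<in> borel_measurable M"
      using measurable_fst'[OF Z] measurable_snd'[OF Z] by simp_all
    then have "(\<lambda>\<omega>. Y t \<omega> - \<mu> (X t \<omega>)) \<in> borel_measurable M"
      using \<mu> by measurable
    then show ?thesis by (simp add: W_def[abs_def])
  qed
  have B: "?B n \<in> borel_measurable M" for n
    by (rule betahat_measurable) (rule W)
  have bounded: "bounded_in_prob M (\<lambda>n \<omega>. ?B n \<omega> - \<beta>)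
      (\<lambda>n. real (hseq n) powr (- \<delta>) + vrate \<beta> n (hseq n))"
    if \<delta>: "0 < \<delta>" "\<delta> < min \<phi> (1 - \<beta>)" for \<delta>
  proof -
    obtain K where "power_law_coefficients a \<beta> c \<delta> K"
      by (rule power_law_coefficientsI[of \<beta> \<delta> \<phi> c g a]) (use \<beta> \<delta> c g in auto)
    then show ?thesis
      by (rule betahat_bounded_in_prob[OF indep normal series W])
  qed
  \<comment> \<open>Any admissible exponent will do for the convergence statements.\<close>
  define \<delta> where "\<delta> = min \<phi> (1 - \<beta>) / 2"
  have \<delta>: "0 < \<delta>" "\<delta> < min \<phi> (1 - \<beta>)" using \<phi> \<beta> by (auto simp: \<delta>_def)
  have "\<forall>\<^sub>F n in sequentially. 0 < ln (real n)" by real_asymp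
  then have log: "tendsto_in_prob M (\<lambda>n \<omega>. (?B n \<omega> - \<beta>) * ln (real n)) 0"
    by (rule bounded_in_prob_imp_tendsto[OF bounded[OF \<delta>] estimation_rate_log_limit[OF \<beta>(1) \<delta>(1)]])
  have "\<forall>\<^sub>F n in sequentially. 1 \<le> bseq \<zeta> n \<and> bseq \<zeta> n \<le> n"
    using eventually_ge_at_top[of 1] by eventually_elim (rule bseq_range[OF \<zeta>])
  then have ratio_b: "tendsto_in_prob M (\<lambda>n \<omega>. R (bseq \<zeta> n) (?B n \<omega>) / R (bseq \<zeta> n) \<beta>) 1"
    by (rule R_ratio_tendsto[OF B log])
  have "\<forall>\<^sub>F n in sequentially. 1 \<le> n \<and> n \<le> n"
    using eventually_ge_at_top[of 1] by eventually_elim simp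
  then have ratio_n: "tendsto_in_prob M (\<lambda>n \<omega>. R n (?B n \<omega>) / R n \<beta>) 1"
    by (rule R_ratio_tendsto[OF B log])
  show ?thesis
    by (intro conjI allI impI bounded log ratio_b ratio_n R_rate_limit) auto
qed

end
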